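(* Let $d\ge2$, let $a\ge1$ be an integer, and consider the $2$-Lipschitz interface dynamics with independent Bernoulli disorder of parameter $p$ described in the context. There exists $p_0>0$ such that for every $p\in(0,p_0)$ and every integer $h\ge10$ the finite size criterion holds: there exist $c,\rho>0$ such that for every integer $L\ge c$, $$\mathbb{P}\big[\text{there exists a surface }S\text{ blocking }C^{h,L}\big]\le L^{-\rho}.$$ Consequently, the speed of the surface is positive: for the evolution started from $S_0\equiv0$, $\liminf_{t\to\infty}S_t(0)/t>0$ almost surely.
   Context: Points of $\mathbb{Z}^d$ are written $(x,y)$, $x\in\mathbb{Z}^{d-1}$, $y\in\mathbb{Z}$. The environment consists of independent random variables $\omega(x,y)$, $(x,y)\in\mathbb{Z}^d$, with $$p=\mathbb{P}\big(\omega(x,y)=-3(d-1)\big)=1-\mathbb{P}\big(\omega(x,y)=1/2\big).$$ Let $\overline{\mathbb{Z}}=\mathbb{Z}\cup\{-\infty\}$, $E=\{\pm e_k:k=1,\dots,d-1\}$, $\partial_eS(x)=S(x+e)-S(x)$. The evolution of a surface $S:\mathbb{Z}^{d-1}\to\overline{\mathbb{Z}}$ is $S_{t+1}(x)=S_t(x)+F\big((\partial_eS_t(x))_{e\in E};\omega(x,S_t(x))\big)$ with $$F(a_1,\dots,a_{2(d-1)},w)=1_{\{a_k>-2\text{ for all }k\}}\ \max\Big(1_{\{a_k=2\text{ for some }k\}},\ 1_{\{a_1+\dots+a_{2(d-1)}+w>0\}}\Big),$$ with the conventions $-\infty+1=-\infty$ and $F=0$ if some partial derivative is $-\infty$. A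 $\mathbb{Z}$-valued function on a subset of $\mathbb{Z}^{d-1}$ is $2$-Lipschitz if its values at nearest neighbours differ by at most $2$; the evolution preserves $2$-Lipschitz surfaces. $S$ is obstructed at $x$ (in a given environment) if one step of the evolution started from $S$ does not change the value at $x$. With $H_L=L^{a+1}$ and integers $h,L\ge1$, let $C^{h,L}=([0,3hL)^{d-1}\times[0,H_L))\cap\mathbb{Z}^d$ and $B^{h,L}=([hL,2hL)^{d-1}\times[0,L))\cap\mathbb{Z}^d$. In this model, a surface $S:\mathbb{Z}^{d-1}\to\overline{\mathbb{Z}}$ blocks $C^{h,L}$ if its restriction to $[0,3hL)^{d-1}$ is $\mathbb{Z}$-valued and $2$-Lipschitz and: (1) the graph of $S$ intersects $B^{h,L}$; (2) $S(x)\ge0$ for every $x\in[0,3hL)^{d-1}$; (3) for every $x\in[0,3hL)^{d-1}$ with $S(x)\le H_L$, $S$ is obstructed at $x$, in the environment equal to $\omega$ on $C^{h,L}$ and $-\infty$ outside $C^{h,L}$. *)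

theory Defs
  imports "HOL-Probability.Probability"
begin

text \<open>
  The dimension \<open>d\<close> is encoded by a finite index type \<open>'n\<close> with \<open>CARD('n) = d - 1\<close>, so that
  points \<open>(x, y)\<close> of \<open>\<int>\<^sup>d\<close> have type \<open>(int ^ 'n) \<times> int\<close>.  Index types are nonempty, hence \<open>d \<ge> 2\<close>.
\<close>

datatype zbar = Neg_Inf | Fin int

primrec ereal_of_zbar :: "zbar \<Rightarrow> ereal" where
  "ereal_of_zbar Neg_Inf = -\<infinity>"
| "ereal_of_zbar (Fin y) = ereal (real_of_int y)"

type_synonym 'n surface = "int ^ 'n \<Rightarrow> zbar"

definition directions :: "(int ^ 'n::finite) set" where
  "directions = {e. \<exists>k. e = axis k 1 \<or> e = - axis k 1}"

text \<open>
  If \<open>S x = -\<infinity>\<close> the difference has no meaning; its value is immaterial, since the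
  evolution leaves the value \<open>-\<infinity>\<close> unchanged.
\<close>

definition pderiv_surface :: "int ^ 'n \<Rightarrow> 'n::finite surface \<Rightarrow> int ^ 'n \<Rightarrow> zbar" where
  "pderiv_surface e S x =
     (case (S (x + e), S x) of (Fin u, Fin v) \<Rightarrow> Fin (u - v) | _ \<Rightarrow> Neg_Inf)"

definition jump_finite :: "(int ^ 'n::finite \<Rightarrow> int) \<Rightarrow> ereal \<Rightarrow> int" where
  "jump_finite a w =
     of_bool (\<forall>e\<in>directions. a e > -2) *
     max (of_bool (\<exists>e\<in>directions. a e = 2))
         (of_bool (ereal (real_of_int (\<Sum>e\<in>directions. a e)) + w > 0))"

definition jump :: "(int ^ 'n::finite \<Rightarrow> zbar) \<Rightarrow> ereal \<Rightarrow> int" where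
  "jump a w =
     (if \<exists>e\<in>directions. a e = Neg_Inf then 0
      else jump_finite (\<lambda>e. case a e of Fin u \<Rightarrow> u | Neg_Inf \<Rightarrow> 0) w)"

text \<open>Environments are \<open>ereal\<close>-valued because the value \<open>-\<infinity>\<close> is used outside finite boxes.\<close>

definition evolve :: "((int ^ 'n) \<times> int \<Rightarrow> ereal) \<Rightarrow> 'n::finite surface \<Rightarrow> 'n surface" where
  "evolve env S x =
     (case S x of
        Neg_Inf \<Rightarrow> Neg_Inf
      | Fin y \<Rightarrow> Fin (y + jump (\<lambda>e. pderiv_surface e S x) (env (x, y))))"

definition surface_at ::
  "((int ^ 'n) \<times> int \<Rightarrow> ereal) \<Rightarrow> 'n::finite surface \<Rightarrow> nat \<Rightarrow> 'n surface" where
  "surface_at env S0 t = (evolve env ^^ t) S0"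

definition obstructed ::
  "((int ^ 'n) \<times> int \<Rightarrow> ereal) \<Rightarrow> 'n::finite surface \<Rightarrow> int ^ 'n \<Rightarrow> bool" where
  "obstructed env S x \<longleftrightarrow> evolve env S x = S x"

definition two_lipschitz_on :: "(int ^ 'n) set \<Rightarrow> 'n::finite surface \<Rightarrow> bool" where
  "two_lipschitz_on D S \<longleftrightarrow>
     (\<forall>x\<in>D. S x \<noteq> Neg_Inf) \<and>
     (\<forall>x\<in>D. \<forall>e\<in>directions. x + e \<in> D \<longrightarrow>
        (\<forall>u v. S (x + e) = Fin u \<longrightarrow> S x = Fin v \<longrightarrow> \<bar>u - v\<bar> \<le> 2))"

definition cube :: "int \<Rightarrow> int \<Rightarrow> (int ^ 'n::finite) set" where
  "cube l u = {x. \<forall>i. l \<le> x $ i \<and> x $ i < u}"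

definition box_height :: "nat \<Rightarrow> nat \<Rightarrow> int" where
  "box_height a L = int L ^ (a + 1)"

definition big_box :: "nat \<Rightarrow> nat \<Rightarrow> nat \<Rightarrow> ((int ^ 'n::finite) \<times> int) set" where
  "big_box a h L = cube 0 (3 * int h * int L) \<times> {0..<box_height a L}"

definition small_box :: "nat \<Rightarrow> nat \<Rightarrow> ((int ^ 'n::finite) \<times> int) set" where
  "small_box h L = cube (int h * int L) (2 * int h * int L) \<times> {0..<int L}"

definition surface_graph :: "'n::finite surface \<Rightarrow> ((int ^ 'n) \<times> int) set" where
  "surface_graph S = {(x, y). S x = Fin y}"

definition restrict_env ::
  "((int ^ 'n::finite) \<times> int) set \<Rightarrow> ((int ^ 'n) \<times> int \<Rightarrow> ereal) \<Rightarrow> (int ^ 'n) \<times> int \<Rightarrow> ereal" where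
  "restrict_env C env z = (if z \<in> C then env z else -\<infinity>)"

definition blocks ::
  "nat \<Rightarrow> nat \<Rightarrow> nat \<Rightarrow> ((int ^ 'n) \<times> int \<Rightarrow> ereal) \<Rightarrow> 'n::finite surface \<Rightarrow> bool" where
  "blocks a h L env S \<longleftrightarrow>
     two_lipschitz_on (cube 0 (3 * int h * int L)) S \<and>
     surface_graph S \<inter> small_box h L \<noteq> {} \<and>
     (\<forall>x \<in> cube 0 (3 * int h * int L). ereal_of_zbar (S x) \<ge> 0) \<and>
     (\<forall>x \<in> cube 0 (3 * int h * int L).
        ereal_of_zbar (S x) \<le> ereal (real_of_int (box_height a L)) \<longrightarrow>
        obstructed (restrict_env (big_box a h L) env) S x)"

text \<open>The obstacle strength is \<open>-3 (d - 1)\<close>, with \<open>d - 1 = CARD('n)\<close>.\<close>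

definition bernoulli_disorder ::
  "real \<Rightarrow> 'w measure \<Rightarrow> ((int ^ 'n::finite) \<times> int \<Rightarrow> 'w \<Rightarrow> real) \<Rightarrow> bool" where
  "bernoulli_disorder p M \<omega> \<longleftrightarrow>
     prob_space M \<and>
     prob_space.indep_vars M (\<lambda>_. borel) \<omega> UNIV \<and>
     (\<forall>z. measure M {s \<in> space M. \<omega> z s = - 3 * real CARD('n)} = p \<and>
          1 - measure M {s \<in> space M. \<omega> z s = 1 / 2} = p)"

end

theory Submission
  imports Defs
begin

text \<open>
  Write \<open>n = d - 1\<close> and call a site pinned if its \<open>\<omega>\<close> is not \<open>1/2\<close>; pins are independent with
  density \<open>p\<close>.

  \<^bold>\<open>Motionless surfaces need many pins.\<close> Let \<open>f\<close> be a 2-Lipschitz surface none of whose sites in a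
  large box around \<open>x\<close> can move.  If a site has a neighbour two units lower, that neighbour sees a
  slope \<open>+2\<close>, so it is motionless only if it has in turn a neighbour two units lower.  A slope \<open>-2\<close>
  therefore starts a descent that ends only at the boundary of the box, and a lower bound on \<open>f\<close>
  excludes this when the box is wide compared with the height of \<open>f\<close> above that bound.  Hence all
  slopes near \<open>x\<close> lie in \<open>{-1, 0, 1}\<close>, and an unpinned site has discrete Laplacian at most \<open>-1\<close>.  As
  the Laplacian sums over a block to a boundary term, a fixed fraction of the graph over a block of
  side \<open>r\<close> is pinned (\<open>stuck_surface_has_dense_pins\<close>).  There are at most \<open>5 ^ r\<^sup>n\<close> surfaces over the
  block through a given point and \<open>2 ^ r\<^sup>n\<close> sets of pinned sites, so for small \<open>p\<close> this has a probability
  exponentially small in \<open>r\<^sup>n\<close> (\<open>weight_dense_graphs\<close>).  A blocking surface is such an \<open>f\<close> with \<open>r\<close> of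
  order \<open>L\<close>, which proves the finite size criterion (\<open>finite_size_criterion\<close>).

  \<^bold>\<open>Backward chains.\<close> For the speed, the surface is followed backwards in time.  Start from \<open>x\<close> at
  time \<open>t\<close>.  If no surface of side \<open>k\<close> just below \<open>(x, S\<^sub>t(x))\<close> is densely pinned, then \<open>T(k)\<close> steps
  earlier, with \<open>T(k)\<close> of order \<open>k ^ (n + 1)\<close>, some point at a distance comparable to the drop was lower
  by at least \<open>k\<close>.  Otherwise the sites of a box of width of order \<open>k\<close> would make too few moves in that
  time, so that at some instant nothing in the box moves, against the first part
  (\<open>descends_if_no_stall\<close>).  Used at a single scale this is too weak: among the sites that the chain may
  visit up to time \<open>t\<close> there are dense graphs of side of order \<open>log t\<close>, or a power of it, and the
  guaranteed speed \<open>k / T(k)\<close> tends to \<open>0\<close>.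

  \<^bold>\<open>Many scales.\<close> Take levels with \<open>L\<^sub>j\<^sub>+\<^sub>1 = L\<^sub>j\<^sup>2\<close>.  A site is bad at level \<open>j + 1\<close> if, within a distance of
  order \<open>L\<^sub>j\<^sub>+\<^sub>1\<close>, there are either a dense graph of side \<open>K 2\<^sup>j\<close> or three sites, bad at level \<open>j\<close>, that
  are mutually far apart on the scale \<open>L\<^sub>j\<close>.  Around a site that is not bad at level \<open>j + 1\<close>, the sites bad
  at level \<open>j\<close> lie in two clusters and occupy \<open>O(L\<^sub>j)\<close> heights.  A descent by \<open>L\<^sub>j\<^sub>+\<^sub>1\<close> hence consists of
  at most \<open>L\<^sub>j\<close> descents of level \<open>j\<close> and of \<open>O(L\<^sub>j)\<close> slow steps of duration \<open>T(K 2\<^sup>j)\<close>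
  (\<open>descends_if_not_bad\<close>).  The slow steps are negligible against \<open>L\<^sub>j\<^sub>+\<^sub>1\<close>, so the duration of a descent
  at level \<open>j\<close> is at most \<open>v L\<^sub>j\<close> with \<open>v\<close> independent of \<open>j\<close> (\<open>descent_time_linear\<close>).

  Badness at three distant places is witnessed by disjoint sets of pins, so the probabilities
  multiply; the cube of the previous probability beats the number of triples, and badness at level \<open>j\<close>
  has probability at most a large negative power of \<open>L\<^sub>j\<close> (\<open>weight_bad\<close>).  By Borel-Cantelli, for all
  large \<open>j\<close> no site within distance \<open>O(L\<^sub>j\<^sub>+\<^sub>1)\<close> of the origin is bad at level \<open>j\<close>.  For \<open>t\<close> between
  \<open>v L\<^sub>j\<close> and \<open>v L\<^sub>j\<^sub>+\<^sub>1\<close>, the chain from the origin at time \<open>t\<close> then descends at speed \<open>1 / v\<close> almost down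
  to time \<open>0\<close>.  Since the surface is never below \<open>0\<close>, this forces \<open>S\<^sub>t(0) \<ge> t / (2 v)\<close>
  (\<open>positive_speed\<close>).
\<close>

section \<open>Geometry of the integer lattice\<close>

definition nbhd :: "int \<Rightarrow> int ^ 'n::finite \<Rightarrow> (int ^ 'n) set" where
  "nbhd r x = {x'. \<forall>i. \<bar>x' $ i - x $ i\<bar> \<le> r}"

definition block :: "nat \<Rightarrow> int ^ 'n::finite \<Rightarrow> (int ^ 'n) set" where
  "block r x = {x'. \<forall>i. x $ i \<le> x' $ i \<and> x' $ i < x $ i + int r}"

lemma card_vec_product:
  fixes X :: "'n::finite \<Rightarrow> int set"
  assumes "\<And>i. finite (X i)"
  shows "finite {x :: int ^ 'n. \<forall>i. x $ i \<in> X i}"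
    and "card {x :: int ^ 'n. \<forall>i. x $ i \<in> X i} = (\<Prod>i\<in>UNIV. card (X i))"
proof -
  have bij: "bij_betw vec_nth {x :: int ^ 'n. \<forall>i. x $ i \<in> X i} (PiE UNIV X)"
    by (rule bij_betw_byWitness[where f' = vec_lambda]) (auto simp: PiE_def)
  have fin: "finite (PiE UNIV X)"
    using assms by (simp add: finite_PiE)
  show "finite {x :: int ^ 'n. \<forall>i. x $ i \<in> X i}"
    using bij fin bij_betw_finite by blast
  show "card {x :: int ^ 'n. \<forall>i. x $ i \<in> X i} = (\<Prod>i\<in>UNIV. card (X i))"
    using bij_betw_same_card[OF bij] by (simp add: card_PiE)
qed

lemma finite_nbhd: "finite (nbhd r x)"
  and card_nbhd: "card (nbhd r (x :: int ^ 'n::finite)) = nat (2 * r + 1) ^ CARD('n)"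
proof -
  have eq: "nbhd r x = {x'. \<forall>i. x' $ i \<in> {x $ i - r .. x $ i + r}}"
    unfolding nbhd_def by (auto simp: abs_le_iff; smt (verit))
  show "finite (nbhd r x)"
    unfolding eq by (rule card_vec_product(1)) simp
  show "card (nbhd r x) = nat (2 * r + 1) ^ CARD('n)"
    unfolding eq by (subst card_vec_product(2)) (auto simp: algebra_simps)
qed

lemma finite_block: "finite (block r x)"
  and card_block: "card (block r (x :: int ^ 'n::finite)) = r ^ CARD('n)"
proof -
  have eq: "block r x = {x'. \<forall>i. x' $ i \<in> {x $ i ..< x $ i + int r}}"
    unfolding block_def by auto
  show "finite (block r x)"
    unfolding eq by (rule card_vec_product(1)) simp
  show "card (block r x) = r ^ CARD('n)"
    unfolding eq by (subst card_vec_product(2)) auto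
qed

lemma card_block_slice:
  fixes x :: "int ^ 'n::finite"
  shows "card {x' \<in> block r x. x' $ k = c} \<le> r ^ (CARD('n) - 1)"
proof -
  let ?X = "\<lambda>i. if i = k then {c} else {x $ i ..< x $ i + int r}"
  have fin: "\<And>i. finite (?X i)"
    by simp
  have "{x' \<in> block r x. x' $ k = c} \<subseteq> {x'. \<forall>i. x' $ i \<in> ?X i}"
    unfolding block_def by auto
  then have "card {x' \<in> block r x. x' $ k = c} \<le> card {x' :: int ^ 'n. \<forall>i. x' $ i \<in> ?X i}"
    by (rule card_mono[OF card_vec_product(1)[OF fin]])
  also have "\<dots> = (\<Prod>i\<in>UNIV. card (?X i))"
    by (rule card_vec_product(2)[OF fin])
  also have "\<dots> = (\<Prod>i\<in>UNIV - {k}. card (?X i))"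
    by (subst prod.remove[of UNIV k]) auto
  also have "\<dots> = (\<Prod>i\<in>UNIV - {k}. r)"
    by (rule prod.cong) auto
  also have "\<dots> = r ^ (CARD('n) - 1)"
    by (simp add: card_Diff_singleton)
  finally show ?thesis .
qed

lemma block_subset_nbhd: "block r x \<subseteq> nbhd (int r - 1) x"
  unfolding block_def nbhd_def by (auto simp: abs_le_iff; smt (verit))

lemma nbhd_mono: "r \<le> s \<Longrightarrow> nbhd r x \<subseteq> nbhd s x"
  unfolding nbhd_def by (auto intro: order_trans)

lemma nbhd_self: "0 \<le> r \<Longrightarrow> x \<in> nbhd r x"
  unfolding nbhd_def by simp

lemma nbhd_trans: "x' \<in> nbhd r x \<Longrightarrow> x'' \<in> nbhd s x' \<Longrightarrow> x'' \<in> nbhd (r + s) x"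
proof -
  assume x': "x' \<in> nbhd r x" and x'': "x'' \<in> nbhd s x'"
  have "\<bar>x'' $ i - x $ i\<bar> \<le> r + s" for i
  proof -
    have "\<bar>x' $ i - x $ i\<bar> \<le> r" "\<bar>x'' $ i - x' $ i\<bar> \<le> s"
      using x' x'' unfolding nbhd_def by auto
    then show ?thesis by linarith
  qed
  then show ?thesis
    unfolding nbhd_def by simp
qed

lemma block_self: "0 < r \<Longrightarrow> x \<in> block r x"
  unfolding block_def by simp

lemma directions_uminus: "e \<in> directions \<Longrightarrow> - e \<in> directions"
  unfolding directions_def by auto

lemma directions_nbhd: "e \<in> directions \<Longrightarrow> x + e \<in> nbhd 1 x"
  unfolding directions_def nbhd_def axis_def by auto

lemma axis_eq_iff_int: "axis k (1::int) = axis l 1 \<longleftrightarrow> k = l"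
  by (auto simp: axis_eq_axis)

lemma axis_neq_uminus_axis: "axis k (1::int) \<noteq> - axis l 1"
proof
  assume "axis k (1::int) = - axis l 1"
  then have "axis k (1::int) $ k = (- axis l 1) $ k" by simp
  then show False by (simp add: axis_def split: if_splits)
qed

lemma directions_eq:
  "directions = (\<lambda>k. axis k 1) ` UNIV \<union> (\<lambda>k. - axis k 1 :: int ^ 'n::finite) ` UNIV"
  unfolding directions_def by auto

lemma finite_directions: "finite (directions :: (int ^ 'n::finite) set)"
  unfolding directions_eq by simp

lemma sum_directions:
  fixes g :: "int ^ 'n::finite \<Rightarrow> 'b::comm_monoid_add"
  shows "sum g directions = (\<Sum>k\<in>UNIV. g (axis k 1) + g (- axis k 1))"
proof -
  have "sum g directions = sum g ((\<lambda>k. axis k 1) ` UNIV) + sum g ((\<lambda>k. - axis k 1) ` UNIV)"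
    unfolding directions_eq by (rule sum.union_disjoint) (auto simp: axis_neq_uminus_axis)
  also have "sum g ((\<lambda>k. axis k 1) ` UNIV) = (\<Sum>k\<in>UNIV. g (axis k 1))"
    by (subst sum.reindex) (auto simp: inj_on_def axis_eq_iff_int)
  also have "sum g ((\<lambda>k. - axis k 1) ` UNIV) = (\<Sum>k\<in>UNIV. g (- axis k 1))"
    by (subst sum.reindex) (auto simp: inj_on_def axis_eq_iff_int)
  finally show ?thesis
    by (simp add: sum.distrib)
qed

lemma card_directions: "card (directions :: (int ^ 'n::finite) set) = 2 * CARD('n)"
  using sum_directions[of "\<lambda>_ :: int ^ 'n. 1 :: nat"] by simp

definition lipschitz_within :: "(int ^ 'n::finite) set \<Rightarrow> (int ^ 'n \<Rightarrow> int) \<Rightarrow> bool" where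
  "lipschitz_within D f \<longleftrightarrow>
     (\<forall>x\<in>D. \<forall>e\<in>directions. x + e \<in> D \<longrightarrow> \<bar>f (x + e) - f x\<bar> \<le> 2)"

lemma lipschitz_within_subset:
  "lipschitz_within D f \<Longrightarrow> D' \<subseteq> D \<Longrightarrow> lipschitz_within D' f"
  unfolding lipschitz_within_def by blast

text \<open>
  A path from \<open>x'\<close> to \<open>x\<close> that changes one coordinate at a time does not leave \<open>D\<close>.
\<close>

lemma lipschitz_within_l1:
  fixes x :: "int ^ 'n::finite"
  assumes lip: "lipschitz_within D f" and "x' \<in> D"
    and between: "\<And>x' x''. x' \<in> D \<Longrightarrow>
      (\<And>i. min (x $ i) (x' $ i) \<le> x'' $ i \<and> x'' $ i \<le> max (x $ i) (x' $ i)) \<Longrightarrow> x'' \<in> D"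
  shows "\<bar>f x' - f x\<bar> \<le> 2 * (\<Sum>i\<in>UNIV. \<bar>x' $ i - x $ i\<bar>)"
  using assms(2)
proof (induction "nat (\<Sum>i\<in>UNIV. \<bar>x' $ i - x $ i\<bar>)" arbitrary: x' rule: less_induct)
  case less
  show ?case
  proof (cases "x' = x")
    case True
    then show ?thesis by simp
  next
    case False
    then obtain k where k: "x' $ k \<noteq> x $ k"
      by (auto simp: vec_eq_iff)
    define e :: "int ^ 'n" where "e = (if x' $ k > x $ k then - axis k 1 else axis k 1)"
    have e: "e \<in> directions"
      unfolding e_def directions_def by auto
    have step: "\<bar>(x' + e) $ k - x $ k\<bar> = \<bar>x' $ k - x $ k\<bar> - 1"
      using k unfolding e_def by (auto simp: axis_def)
    have other: "(x' + e) $ i = x' $ i" if "i \<noteq> k" for i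
      using that unfolding e_def by (auto simp: axis_def)
    have inside: "x' + e \<in> D"
    proof (rule between[OF less.prems])
      fix i
      show "min (x $ i) (x' $ i) \<le> (x' + e) $ i \<and> (x' + e) $ i \<le> max (x $ i) (x' $ i)"
        using k unfolding e_def by (cases "i = k") (auto simp: axis_def)
    qed
    have "(\<Sum>i\<in>UNIV. \<bar>(x' + e) $ i - x $ i\<bar>)
        = \<bar>(x' + e) $ k - x $ k\<bar> + (\<Sum>i\<in>UNIV - {k}. \<bar>(x' + e) $ i - x $ i\<bar>)"
      by (rule sum.remove) auto
    also have "(\<Sum>i\<in>UNIV - {k}. \<bar>(x' + e) $ i - x $ i\<bar>) = (\<Sum>i\<in>UNIV - {k}. \<bar>x' $ i - x $ i\<bar>)"
      by (rule sum.cong[OF refl]) (use other in \<open>auto simp del: vector_add_component\<close>)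
    also have "\<bar>(x' + e) $ k - x $ k\<bar> + (\<Sum>i\<in>UNIV - {k}. \<bar>x' $ i - x $ i\<bar>)
        = (\<Sum>i\<in>UNIV. \<bar>x' $ i - x $ i\<bar>) - 1"
      by (subst sum.remove[of UNIV k]) (use step in auto)
    finally have dist: "(\<Sum>i\<in>UNIV. \<bar>(x' + e) $ i - x $ i\<bar>) = (\<Sum>i\<in>UNIV. \<bar>x' $ i - x $ i\<bar>) - 1" .
    have "0 \<le> (\<Sum>i\<in>UNIV. \<bar>(x' + e) $ i - x $ i\<bar>)"
      by (rule sum_nonneg) simp
    then have smaller: "nat (\<Sum>i\<in>UNIV. \<bar>(x' + e) $ i - x $ i\<bar>) < nat (\<Sum>i\<in>UNIV. \<bar>x' $ i - x $ i\<bar>)"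
      using dist by linarith
    have "\<bar>f (x' + e) - f x\<bar> \<le> 2 * (\<Sum>i\<in>UNIV. \<bar>(x' + e) $ i - x $ i\<bar>)"
      by (rule less.hyps[OF smaller inside])
    moreover have "\<bar>f (x' + e) - f x'\<bar> \<le> 2"
      using lip less.prems e inside unfolding lipschitz_within_def by blast
    ultimately show ?thesis
      using dist by linarith
  qed
qed

lemma lipschitz_within_nbhd:
  fixes x :: "int ^ 'n::finite"
  assumes "lipschitz_within (nbhd R x) f" and "x' \<in> nbhd r x" and "r \<le> R"
  shows "\<bar>f x' - f x\<bar> \<le> 2 * int CARD('n) * r"
proof -
  have x': "x' \<in> nbhd R x"
    using assms nbhd_mono by blast
  have "\<bar>f x' - f x\<bar> \<le> 2 * (\<Sum>i\<in>UNIV. \<bar>x' $ i - x $ i\<bar>)"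
  proof (rule lipschitz_within_l1[OF assms(1) x'])
    fix x1 x2 :: "int ^ 'n"
    assume x1: "x1 \<in> nbhd R x"
      and x2: "\<And>i. min (x $ i) (x1 $ i) \<le> x2 $ i \<and> x2 $ i \<le> max (x $ i) (x1 $ i)"
    have "\<bar>x2 $ i - x $ i\<bar> \<le> R" for i
    proof -
      have "\<bar>x1 $ i - x $ i\<bar> \<le> R"
        using x1 unfolding nbhd_def by auto
      with x2[of i] show ?thesis
        by (auto simp: min_def max_def split: if_splits)
    qed
    then show "x2 \<in> nbhd R x"
      unfolding nbhd_def by simp
  qed
  also have "(\<Sum>i\<in>UNIV. \<bar>x' $ i - x $ i\<bar>) \<le> (\<Sum>i\<in>(UNIV :: 'n set). r)"
    using assms(2) unfolding nbhd_def by (intro sum_mono) auto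
  finally show ?thesis by simp
qed

lemma lipschitz_within_block:
  fixes x :: "int ^ 'n::finite"
  assumes "lipschitz_within (block r x) f" and x': "x' \<in> block r x"
  shows "\<bar>f x' - f x\<bar> \<le> 2 * int CARD('n) * int r"
proof -
  have "\<bar>f x' - f x\<bar> \<le> 2 * (\<Sum>i\<in>UNIV. \<bar>x' $ i - x $ i\<bar>)"
  proof (rule lipschitz_within_l1[OF assms(1) x'])
    fix x1 x2 :: "int ^ 'n"
    assume x1: "x1 \<in> block r x"
      and x2: "\<And>i. min (x $ i) (x1 $ i) \<le> x2 $ i \<and> x2 $ i \<le> max (x $ i) (x1 $ i)"
    have "x $ i \<le> x2 $ i \<and> x2 $ i < x $ i + int r" for i
    proof -
      have "x $ i \<le> x1 $ i" "x1 $ i < x $ i + int r"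
        using x1 unfolding block_def by auto
      with x2[of i] show ?thesis
        by (auto simp: min_def max_def split: if_splits)
    qed
    then show "x2 \<in> block r x"
      unfolding block_def by simp
  qed
  also have "(\<Sum>i\<in>UNIV. \<bar>x' $ i - x $ i\<bar>) \<le> (\<Sum>i\<in>(UNIV :: 'n set). int r)"
    using x' unfolding block_def by (intro sum_mono) (auto simp: abs_le_iff less_imp_le algebra_simps)
  finally show ?thesis by simp
qed

section \<open>A stuck surface meets a positive density of pins\<close>

text \<open>
  What remains of a surface not moving at \<open>x\<close> once the disorder is reduced to the set \<open>A\<close> of pinned
  sites: at these nothing is asked of the sum of the slopes, and all others carry the value \<open>1/2\<close>, for
  which \<open>sum + 1/2 > 0\<close> fails exactly when the integer sum is at most \<open>-1\<close>.
\<close>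

definition stuck :: "((int ^ 'n) \<times> int) set \<Rightarrow> (int ^ 'n::finite \<Rightarrow> int) \<Rightarrow> int ^ 'n \<Rightarrow> bool" where
  "stuck A f x \<longleftrightarrow>
     (\<exists>e\<in>directions. f (x + e) - f x \<le> -2) \<or>
     ((\<forall>e\<in>directions. f (x + e) - f x \<noteq> 2) \<and>
      ((x, f x) \<in> A \<or> (\<Sum>e\<in>directions. f (x + e) - f x) \<le> -1))"

text \<open>
  A neighbour reached by a slope \<open>-2\<close> looks back at a slope \<open>+2\<close>.  That alone would make it move,
  unless it has a slope \<open>-2\<close> of its own.
\<close>

lemma steep_descent:
  fixes x :: "int ^ 'n::finite"
  assumes lip: "lipschitz_within (nbhd R x) f"
    and stuck: "\<And>x'. x' \<in> nbhd (R - 1) x \<Longrightarrow> stuck A f x'"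
    and start: "x0 \<in> nbhd r x" "e0 \<in> directions" "f (x0 + e0) - f x0 \<le> -2"
    and "r + int i \<le> R"
  shows "\<exists>x'. x' \<in> nbhd (r + int i) x \<and> f x' \<le> f x0 - 2 * int i \<and>
           (r + int i \<le> R - 1 \<longrightarrow> (\<exists>e\<in>directions. f (x' + e) - f x' \<le> -2))"
  using \<open>r + int i \<le> R\<close>
proof (induction i)
  case 0
  then show ?case using start by auto
next
  case (Suc i)
  then obtain x' e where x': "x' \<in> nbhd (r + int i) x" "f x' \<le> f x0 - 2 * int i"
    and e: "e \<in> directions" "f (x' + e) - f x' \<le> -2"
    by auto
  have next_in: "x' + e \<in> nbhd (r + int (Suc i)) x"
    using nbhd_trans[OF x'(1) directions_nbhd[OF e(1)]] by (simp add: algebra_simps)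
  have drop: "f (x' + e) \<le> f x0 - 2 * int (Suc i)"
    using x' e by simp
  have "\<exists>e'\<in>directions. f (x' + e + e') - f (x' + e) \<le> -2" if "r + int (Suc i) \<le> R - 1"
  proof -
    have "x' + e \<in> nbhd (R - 1) x"
      using next_in nbhd_mono[OF that] by blast
    then have "stuck A f (x' + e)"
      by (rule stuck)
    moreover have "f (x' + e + - e) - f (x' + e) = 2"
    proof -
      have "x' \<in> nbhd R x" "x' + e \<in> nbhd R x"
        using x'(1) next_in nbhd_mono[of "r + int i" R] nbhd_mono[of "r + int (Suc i)" R] Suc.prems
        by auto
      then have "\<bar>f (x' + e) - f x'\<bar> \<le> 2"
        using lip e(1) unfolding lipschitz_within_def by blast
      with e(2) show ?thesis by simp
    qed
    ultimately show ?thesis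
      using directions_uminus[OF e(1)] unfolding stuck_def by blast
  qed
  with next_in drop show ?case by blast
qed

text \<open>Summation by parts: only the two faces of the block orthogonal to direction \<open>k\<close> contribute.\<close>

lemma sum_second_difference_block:
  fixes x :: "int ^ 'n::finite"
  assumes slope: "\<And>x' e. x' \<in> block r x \<Longrightarrow> e \<in> directions \<Longrightarrow> \<bar>f (x' + e) - f x'\<bar> \<le> (1::int)"
  shows "(\<Sum>x'\<in>block r x. (f (x' + axis k 1) - f x') + (f (x' + - axis k 1) - f x'))
           \<ge> - 2 * int r ^ (CARD('n) - 1)"
proof -
  let ?Q = "block r x"
  let ?a = "axis k (1::int)"
  define u where "u x' = f (x' + ?a) - f x'" for x'
  have adir: "?a \<in> directions" "- ?a \<in> directions"
    unfolding directions_def by auto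
  let ?Q' = "(\<lambda>x'. x' - ?a) ` ?Q"
  have fin: "finite ?Q" "finite ?Q'"
    using finite_block by auto
  have inj: "inj_on (\<lambda>x'. x' - ?a) ?Q"
    by (simp add: inj_on_def)
  have "(\<Sum>x'\<in>?Q. (f (x' + ?a) - f x') + (f (x' + - ?a) - f x')) = (\<Sum>x'\<in>?Q. u x' - u (x' - ?a))"
    unfolding u_def by (rule sum.cong) (auto simp: algebra_simps)
  also have "\<dots> = sum u ?Q - sum u ?Q'"
    by (simp add: sum_subtractf sum.reindex[OF inj])
  also have "\<dots> = sum u (?Q - ?Q') - sum u (?Q' - ?Q)"
    using sum.Int_Diff[OF fin(1), of u ?Q'] sum.Int_Diff[OF fin(2), of u ?Q]
    by (simp add: Int_commute)
  finally have eq: "(\<Sum>x'\<in>?Q. (f (x' + ?a) - f x') + (f (x' + - ?a) - f x'))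
      = sum u (?Q - ?Q') - sum u (?Q' - ?Q)" .
  have bound: "card (?Q - ?Q') \<le> r ^ (CARD('n) - 1)"
  proof -
    have "?Q - ?Q' \<subseteq> {x' \<in> ?Q. x' $ k = x $ k + int r - 1}"
    proof
      fix x' assume "x' \<in> ?Q - ?Q'"
      then have "x' \<in> ?Q" "x' + ?a \<notin> ?Q"
        by (force simp: image_iff)+
      then show "x' \<in> {x' \<in> ?Q. x' $ k = x $ k + int r - 1}"
        unfolding block_def by (auto simp: axis_def split: if_splits; smt (verit))
    qed
    then have "card (?Q - ?Q') \<le> card {x' \<in> ?Q. x' $ k = x $ k + int r - 1}"
      by (rule card_mono[rotated]) (simp add: finite_block)
    also have "\<dots> \<le> r ^ (CARD('n) - 1)"
      by (rule card_block_slice)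
    finally show ?thesis .
  qed
  have bound': "card (?Q' - ?Q) \<le> r ^ (CARD('n) - 1)"
  proof -
    have "card (?Q' - ?Q) = card (?Q - ?Q')"
    proof -
      have "card ?Q' = card ?Q"
        by (rule card_image[OF inj])
      then show ?thesis
        using card_Diff_subset_Int[of ?Q ?Q'] card_Diff_subset_Int[of ?Q' ?Q] fin
        by (simp add: Int_commute)
    qed
    with bound show ?thesis by simp
  qed
  have "sum u (?Q - ?Q') \<ge> - int (card (?Q - ?Q'))"
  proof -
    have "- 1 \<le> u x'" if "x' \<in> ?Q" for x'
      using slope[OF that adir(1)] unfolding u_def by linarith
    then have "(\<Sum>x'\<in>?Q - ?Q'. - 1) \<le> sum u (?Q - ?Q')"
      by (intro sum_mono) auto
    then show ?thesis by simp
  qed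
  moreover have "sum u (?Q' - ?Q) \<le> int (card (?Q' - ?Q))"
  proof -
    have "u x' \<le> 1" if "x' \<in> ?Q'" for x'
    proof -
      from that obtain x'' where x'': "x'' \<in> ?Q" "x' = x'' - ?a" by auto
      have "\<bar>f (x'' + - ?a) - f x''\<bar> \<le> 1"
        by (rule slope[OF x''(1) adir(2)])
      then show ?thesis
        unfolding u_def x''(2) by simp
    qed
    then have "sum u (?Q' - ?Q) \<le> (\<Sum>x'\<in>?Q' - ?Q. 1)"
      by (intro sum_mono) auto
    then show ?thesis by simp
  qed
  ultimately show ?thesis
    unfolding eq using bound bound' by (simp flip: of_nat_power)
qed

lemma side_le_radius:
  assumes "L + 2 * int m * int r \<le> 2 * (R - int r)" and "0 \<le> L"
  shows "int r \<le> R"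
proof -
  define X where "X = 2 * int m * int r"
  have "0 \<le> X"
    unfolding X_def by simp
  then have "0 \<le> 2 * (R - int r)"
    using assms unfolding X_def[symmetric] by (simp add: algebra_simps)
  then show ?thesis by simp
qed

text \<open>
  The hypothesis on \<open>R\<close> leaves a steep descent from the block no room above the level \<open>m\<close>, which
  confines the slopes on the block to \<open>{-1, 0, 1}\<close>.  The sum of the Laplacian over the block is at least
  \<open>- 2 n r ^ (n - 1)\<close>, while an unpinned site contributes at most \<open>-1\<close> and a pinned one at most \<open>2 n\<close>.
  With \<open>4 n \<le> r\<close> the boundary term costs no more than half of the block.
\<close>

lemma stuck_surface_has_dense_pins:
  fixes x :: "int ^ 'n::finite"
  assumes lip: "lipschitz_within (nbhd R x) f"
    and stuck: "\<And>x'. x' \<in> nbhd (R - 1) x \<Longrightarrow> stuck A f x'"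
    and low: "\<And>x'. x' \<in> nbhd R x \<Longrightarrow> m \<le> f x'"
    and start: "f x < m + L"
    and size: "L + 2 * int CARD('n) * int r \<le> 2 * (R - int r)" "0 \<le> L" "4 * CARD('n) \<le> r"
  shows "r ^ CARD('n) \<le> (4 * CARD('n) + 2) * card {x' \<in> block r x. (x', f x') \<in> A}"
proof -
  let ?n = "CARD('n)"
  let ?Q = "block r x"
  have n: "1 \<le> ?n"
    using zero_less_card_finite[where 'a='n] by linarith
  have r: "1 \<le> r"
    using size(3) n by linarith
  have rR: "int r \<le> R"
    by (rule side_le_radius[OF size(1,2)])
  have no_drop: "f (x' + e) - f x' \<ge> -1" if x': "x' \<in> ?Q" and e: "e \<in> directions" for x' e
  proof (rule ccontr)
    assume "\<not> ?thesis"
    then have steep: "f (x' + e) - f x' \<le> -2" by simp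
    have x'_nbhd: "x' \<in> nbhd (int r - 1) x"
      using x' block_subset_nbhd by blast
    define i where "i = nat (R - (int r - 1))"
    have i: "int i = R - (int r - 1)"
      unfolding i_def using rR by simp
    obtain x'' where "x'' \<in> nbhd (int r - 1 + int i) x" "f x'' \<le> f x' - 2 * int i"
      using steep_descent[OF lip stuck x'_nbhd e steep, of i] i by auto
    then have "m \<le> f x' - 2 * int i"
      using low[of x''] i by simp
    moreover have "f x' \<le> f x + 2 * int ?n * (int r - 1)"
      using lipschitz_within_nbhd[OF lip x'_nbhd] rR by linarith
    moreover have "2 * int ?n * (int r - 1) \<le> 2 * int ?n * int r"
      by (intro mult_left_mono) auto
    moreover define X where "X = 2 * int ?n * int r"
    ultimately have "m < m + L + X - 2 * int i"
      using start unfolding X_def[symmetric] by linarith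
    moreover have "L + X \<le> 2 * (R - int r)"
      using size(1) unfolding X_def .
    ultimately show False
      using i by (simp add: algebra_simps)
  qed
  have inner: "x' \<in> nbhd (R - 1) x" if "x' \<in> ?Q" for x'
    using that block_subset_nbhd[of r x] nbhd_mono[of "int r - 1" "R - 1" x] rR by auto
  have slope: "\<bar>f (x' + e) - f x'\<bar> \<le> 1" if x': "x' \<in> ?Q" and e: "e \<in> directions" for x' e
  proof -
    have "stuck A f x'"
      using inner[OF x'] by (rule stuck)
    then have "f (x' + e) - f x' \<noteq> 2"
      using no_drop[OF x'] e unfolding stuck_def by force
    moreover have "\<bar>f (x' + e) - f x'\<bar> \<le> 2"
    proof -
      have "x' + e \<in> nbhd R x" "x' \<in> nbhd R x"
        using nbhd_trans[OF inner[OF x'] directions_nbhd[OF e]] inner[OF x'] nbhd_mono[of "R - 1" R x]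
        by auto
      then show ?thesis
        using lip e unfolding lipschitz_within_def by blast
    qed
    ultimately show ?thesis
      using no_drop[OF x' e] by linarith
  qed
  let ?lap = "\<lambda>x'. \<Sum>e\<in>directions. f (x' + e) - f x'"
  let ?P = "{x' \<in> ?Q. (x', f x') \<in> A}"
  have lap_free: "?lap x' \<le> -1" if "x' \<in> ?Q - ?P" for x'
  proof -
    have x': "x' \<in> ?Q" "(x', f x') \<notin> A"
      using that by auto
    have "stuck A f x'"
      using inner[OF x'(1)] by (rule stuck)
    then show ?thesis
      using x'(2) no_drop[OF x'(1)] unfolding stuck_def by force
  qed
  have lap_pin: "?lap x' \<le> 2 * int ?n" if "x' \<in> ?P" for x'
  proof -
    have "?lap x' \<le> (\<Sum>e\<in>(directions :: (int ^ 'n) set). 1)"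
    proof (rule sum_mono)
      fix e :: "int ^ 'n" assume "e \<in> directions"
      then show "f (x' + e) - f x' \<le> 1"
        using slope[of x' e] that by auto
    qed
    then show ?thesis
      by (simp add: card_directions)
  qed
  have finP: "finite ?P"
    by (simp add: finite_block)
  have "(\<Sum>x'\<in>?Q. ?lap x') = (\<Sum>x'\<in>?Q - ?P. ?lap x') + (\<Sum>x'\<in>?P. ?lap x')"
    by (rule sum.subset_diff) (auto simp: finite_block)
  also have "\<dots> \<le> (\<Sum>x'\<in>?Q - ?P. -1) + (\<Sum>x'\<in>?P. 2 * int ?n)"
    by (intro add_mono sum_mono lap_free lap_pin) auto
  also have "\<dots> = - int (card (?Q - ?P)) + 2 * int ?n * int (card ?P)"
    by simp
  also have "int (card (?Q - ?P)) = int (r ^ ?n) - int (card ?P)"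
    using card_Diff_subset[OF finP, of ?Q] card_mono[OF finite_block, of ?P r x]
    by (simp add: card_block of_nat_diff del: of_nat_power)
  finally have upper: "(\<Sum>x'\<in>?Q. ?lap x') \<le> (2 * int ?n + 1) * int (card ?P) - int (r ^ ?n)"
    by (simp add: algebra_simps)
  have "(\<Sum>x'\<in>?Q. ?lap x')
      = (\<Sum>k\<in>UNIV. \<Sum>x'\<in>?Q. (f (x' + axis k 1) - f x') + (f (x' + - axis k 1) - f x'))"
    unfolding sum_directions by (rule sum.swap)
  also have "\<dots> \<ge> (\<Sum>k\<in>(UNIV :: 'n set). - 2 * int r ^ (?n - 1))"
    by (intro sum_mono sum_second_difference_block slope)
  finally have "- (2 * int ?n * int r ^ (?n - 1)) \<le> (2 * int ?n + 1) * int (card ?P) - int (r ^ ?n)"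
    using upper by simp
  moreover have "4 * int ?n * int r ^ (?n - 1) \<le> int (r ^ ?n)"
  proof -
    have "4 * int ?n * int r ^ (?n - 1) \<le> int r * int r ^ (?n - 1)"
      using size(3) by (intro mult_right_mono) auto
    also have "\<dots> = int (r ^ ?n)"
      using n by (cases ?n) auto
    finally show ?thesis .
  qed
  ultimately have "int (r ^ ?n) \<le> (4 * int ?n + 2) * int (card ?P)"
    by (simp add: algebra_simps)
  also have "\<dots> = int ((4 * ?n + 2) * card ?P)"
    by (simp only: of_nat_mult of_nat_add of_nat_numeral)
  finally show ?thesis
    by (simp only: of_nat_le_iff)
qed

section \<open>Witness families and their weights\<close>

text \<open>
  A rare event is encoded by a finite family of finite sets of sites, its witnesses: the event occurs
  when some witness consists of pins only.  A bound on its probability then needs no more than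
  \<open>P(W \<subseteq> pins) = p ^ card W\<close>, and distant events enter only through the disjointness of their
  witnesses.
\<close>

definition hit :: "'a set set \<Rightarrow> 'a set \<Rightarrow> bool" where
  "hit F A \<longleftrightarrow> (\<exists>W\<in>F. W \<subseteq> A)"

definition weight :: "real \<Rightarrow> 'a set set \<Rightarrow> real" where
  "weight p F = (\<Sum>W\<in>F. p ^ card W)"

lemma weight_UN:
  assumes "0 \<le> p" "finite I" "\<And>i. i \<in> I \<Longrightarrow> finite (F i)"
  shows "weight p (\<Union>i\<in>I. F i) \<le> (\<Sum>i\<in>I. weight p (F i))"
proof -
  have "weight p (\<Union>i\<in>I. F i) = (\<Sum>W\<in>snd ` Sigma I F. p ^ card W)"
    unfolding weight_def by (rule sum.cong) force+
  also have "\<dots> \<le> (\<Sum>q\<in>Sigma I F. p ^ card (snd q))"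
    using sum_image_le[of "Sigma I F" "\<lambda>W. p ^ card W" snd] assms by (simp add: o_def)
  also have "\<dots> = (\<Sum>i\<in>I. weight p (F i))"
    unfolding weight_def by (subst sum.Sigma) (use assms in \<open>auto simp: case_prod_beta\<close>)
  finally show ?thesis .
qed

lemma weight_Un:
  assumes "0 \<le> p" "finite F" "finite G"
  shows "weight p (F \<union> G) \<le> weight p F + weight p G"
  using weight_UN[of p "{True, False}" "\<lambda>b. if b then F else G"] assms by (auto simp: Un_commute)

definition pins :: "('z \<Rightarrow> 'w \<Rightarrow> real) \<Rightarrow> 'w \<Rightarrow> 'z set" where
  "pins \<omega> s = {z. \<omega> z s \<noteq> 1 / 2}"

lemma bernoulli_pins:
  fixes \<omega> :: "(int ^ 'n::finite) \<times> int \<Rightarrow> 'w \<Rightarrow> real"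
  assumes "bernoulli_disorder p M \<omega>" and "finite W"
  shows "{s \<in> space M. W \<subseteq> pins \<omega> s} \<in> sets M"
    and "measure M {s \<in> space M. W \<subseteq> pins \<omega> s} = p ^ card W"
proof -
  interpret prob_space M
    using assms unfolding bernoulli_disorder_def by simp
  have indep: "indep_vars (\<lambda>_. borel) \<omega> UNIV"
    and half: "\<And>z. 1 - measure M {s \<in> space M. \<omega> z s = 1 / 2} = p"
    using assms unfolding bernoulli_disorder_def by auto
  have meas [measurable]: "\<omega> z \<in> borel_measurable M" for z
    using indep unfolding indep_vars_def by (cases z) simp
  let ?B = "\<lambda>z. \<omega> z -` (- {1 / 2}) \<inter> space M"
  have single: "prob (?B z) = p" for z
  proof -
    have "?B z = space M - {s \<in> space M. \<omega> z s = 1 / 2}"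
      by auto
    then have "prob (?B z) = prob (space M - {s \<in> space M. \<omega> z s = 1 / 2})"
      by simp
    also have "\<dots> = 1 - prob {s \<in> space M. \<omega> z s = 1 / 2}"
      by (rule prob_compl) measurable
    finally show ?thesis
      using half by simp
  qed
  have "{s \<in> space M. W \<subseteq> pins \<omega> s} \<in> sets M \<and>
        prob {s \<in> space M. W \<subseteq> pins \<omega> s} = p ^ card W"
  proof (cases "W = {}")
    case True
    then show ?thesis
      by (simp add: prob_space)
  next
    case False
    then have eq: "{s \<in> space M. W \<subseteq> pins \<omega> s} = (\<Inter>z\<in>W. ?B z)"
      unfolding pins_def by auto
    have "prob (\<Inter>z\<in>W. ?B z) = (\<Prod>z\<in>W. prob (?B z))"
      by (rule indep_varsD[OF indep]) (use False assms(2) in auto)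
    moreover have "(\<Inter>z\<in>W. ?B z) \<in> sets M"
      by (rule sets.finite_INT) (use False assms(2) in auto)
    ultimately show ?thesis
      unfolding eq using single by simp
  qed
  then show "{s \<in> space M. W \<subseteq> pins \<omega> s} \<in> sets M"
    and "measure M {s \<in> space M. W \<subseteq> pins \<omega> s} = p ^ card W"
    by auto
qed

lemma bernoulli_hit:
  fixes \<omega> :: "(int ^ 'n::finite) \<times> int \<Rightarrow> 'w \<Rightarrow> real"
  assumes ber: "bernoulli_disorder p M \<omega>" and fin: "finite F" "\<And>W. W \<in> F \<Longrightarrow> finite W"
  shows "{s \<in> space M. hit F (pins \<omega> s)} \<in> sets M"
    and "measure M {s \<in> space M. hit F (pins \<omega> s)} \<le> weight p F"
proof -
  interpret prob_space M
    using ber unfolding bernoulli_disorder_def by simp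
  have eq: "{s \<in> space M. hit F (pins \<omega> s)} = (\<Union>W\<in>F. {s \<in> space M. W \<subseteq> pins \<omega> s})"
    unfolding hit_def by auto
  show "{s \<in> space M. hit F (pins \<omega> s)} \<in> sets M"
    unfolding eq by (rule sets.finite_UN) (use fin bernoulli_pins(1)[OF ber] in auto)
  have "prob (\<Union>W\<in>F. {s \<in> space M. W \<subseteq> pins \<omega> s})
      \<le> (\<Sum>W\<in>F. prob {s \<in> space M. W \<subseteq> pins \<omega> s})"
    by (rule finite_measure_subadditive_finite) (use fin bernoulli_pins(1)[OF ber] in auto)
  also have "\<dots> = weight p F"
    unfolding weight_def by (rule sum.cong) (use fin bernoulli_pins(2)[OF ber] in auto)
  finally show "measure M {s \<in> space M. hit F (pins \<omega> s)} \<le> weight p F"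
    unfolding eq .
qed

section \<open>Counting surfaces over a block\<close>

definition block_surfaces :: "nat \<Rightarrow> int ^ 'n::finite \<Rightarrow> int \<Rightarrow> (int ^ 'n \<Rightarrow> int) set" where
  "block_surfaces r x y =
     {f \<in> extensional (block r x). f x = y \<and> lipschitz_within (block r x) f}"

text \<open>
  The neighbour of \<open>x'\<close> on a lattice path to the corner \<open>x\<close> of the block (with \<open>x\<close> its own parent).  A
  surface over the block is determined by its value at \<open>x\<close> and its differences along these edges.
\<close>

definition parent :: "int ^ 'n::finite \<Rightarrow> int ^ 'n \<Rightarrow> int ^ 'n" where
  "parent x x' = x' + (if x' = x then 0 else - axis (SOME i. x' $ i \<noteq> x $ i) 1)"

lemma parent:
  fixes x :: "int ^ 'n::finite"
  assumes "x' \<in> block r x" "x' \<noteq> x"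
  shows "parent x x' \<in> block r x"
    and "\<exists>e\<in>directions. parent x x' = x' + e"
    and "nat (\<Sum>i\<in>UNIV. parent x x' $ i - x $ i) < nat (\<Sum>i\<in>UNIV. x' $ i - x $ i)"
proof -
  define k where "k = (SOME i. x' $ i \<noteq> x $ i)"
  have "\<exists>i. x' $ i \<noteq> x $ i"
    using assms(2) by (auto simp: vec_eq_iff)
  then have k: "x' $ k \<noteq> x $ k"
    unfolding k_def by (rule someI_ex)
  have eq: "parent x x' = x' + - axis k 1"
    using assms(2) unfolding parent_def k_def by simp
  have at_k: "x $ k \<le> x' $ k - 1" "x' $ k - 1 < x $ k + int r"
  proof -
    have "x $ k \<le> x' $ k" "x' $ k < x $ k + int r"
      using assms(1) unfolding block_def by auto
    with k show "x $ k \<le> x' $ k - 1" "x' $ k - 1 < x $ k + int r" by auto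
  qed
  show "\<exists>e\<in>directions. parent x x' = x' + e"
    unfolding eq directions_def by auto
  have comp: "parent x x' $ i = (if i = k then x' $ k - 1 else x' $ i)" for i
    unfolding eq by (simp add: axis_def)
  show "parent x x' \<in> block r x"
    using assms(1) at_k unfolding block_def by (auto simp: comp)
  have "(\<Sum>i\<in>UNIV. parent x x' $ i - x $ i)
      = (parent x x' $ k - x $ k) + (\<Sum>i\<in>UNIV - {k}. parent x x' $ i - x $ i)"
    by (rule sum.remove) auto
  also have "(\<Sum>i\<in>UNIV - {k}. parent x x' $ i - x $ i) = (\<Sum>i\<in>UNIV - {k}. x' $ i - x $ i)"
    by (rule sum.cong) (auto simp: comp)
  also have "(parent x x' $ k - x $ k) + (\<Sum>i\<in>UNIV - {k}. x' $ i - x $ i)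
      = (\<Sum>i\<in>UNIV. x' $ i - x $ i) - 1"
    by (subst sum.remove[of UNIV k]) (auto simp: comp)
  finally have "(\<Sum>i\<in>UNIV. parent x x' $ i - x $ i) = (\<Sum>i\<in>UNIV. x' $ i - x $ i) - 1" .
  moreover have "0 < (\<Sum>i\<in>UNIV. x' $ i - x $ i)"
    by (rule sum_pos2[of UNIV k]) (use assms(1) at_k in \<open>auto simp: block_def\<close>)
  ultimately show "nat (\<Sum>i\<in>UNIV. parent x x' $ i - x $ i) < nat (\<Sum>i\<in>UNIV. x' $ i - x $ i)"
    by simp
qed

lemma block_surfaces_count:
  fixes x :: "int ^ 'n::finite"
  shows "finite (block_surfaces r x y)"
    and "card (block_surfaces r x y) \<le> 5 ^ (r ^ CARD('n))"
proof -
  let ?Q = "block r x"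
  define \<Delta> where "\<Delta> f = restrict (\<lambda>x'. f x' - f (parent x x')) ?Q" for f :: "int ^ 'n \<Rightarrow> int"
  let ?T = "PiE ?Q (\<lambda>_. {-2..2::int})"
  have "finite ?T"
    by (intro finite_PiE) (auto simp: finite_block)
  have card_T: "card ?T = 5 ^ (r ^ CARD('n))"
    by (simp add: card_PiE finite_block card_block)
  have maps: "\<Delta> ` block_surfaces r x y \<subseteq> ?T"
  proof -
    have "f x' - f (parent x x') \<in> {-2..2}" if f: "f \<in> block_surfaces r x y" and x': "x' \<in> ?Q" for f x'
    proof (cases "x' = x")
      case True
      then show ?thesis by (simp add: parent_def)
    next
      case False
      obtain e where "e \<in> directions" "parent x x' = x' + e"
        using parent(2)[OF x' False] by blast
      then have "\<bar>f (parent x x') - f x'\<bar> \<le> 2"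
        using f x' parent(1)[OF x' False]
        unfolding block_surfaces_def lipschitz_within_def by auto
      then show ?thesis by auto
    qed
    then show ?thesis
      unfolding \<Delta>_def by (auto simp: PiE_def Pi_def)
  qed
  have inj: "inj_on \<Delta> (block_surfaces r x y)"
  proof (rule inj_onI)
    fix f g assume f: "f \<in> block_surfaces r x y" and g: "g \<in> block_surfaces r x y"
      and eq: "\<Delta> f = \<Delta> g"
    have "f x' = g x'" if "x' \<in> ?Q" for x'
      using that
    proof (induction "nat (\<Sum>i\<in>UNIV. x' $ i - x $ i)" arbitrary: x' rule: less_induct)
      case less
      show ?case
      proof (cases "x' = x")
        case True
        then show ?thesis
          using f g unfolding block_surfaces_def by simp
      next
        case False
        have "f (parent x x') = g (parent x x')"
          using less parent[OF less.prems False] by blast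
        moreover have "f x' - f (parent x x') = g x' - g (parent x x')"
          using fun_cong[OF eq, of x'] less.prems unfolding \<Delta>_def by simp
        ultimately show ?thesis by simp
      qed
    qed
    then show "f = g"
      using f g unfolding block_surfaces_def by (auto intro: extensionalityI)
  qed
  show "finite (block_surfaces r x y)"
    using inj_on_finite[OF inj maps \<open>finite ?T\<close>] .
  show "card (block_surfaces r x y) \<le> 5 ^ (r ^ CARD('n))"
    using card_inj_on_le[OF inj maps \<open>finite ?T\<close>] card_T by simp
qed

definition graph_over :: "(int ^ 'n \<Rightarrow> int) \<Rightarrow> (int ^ 'n::finite) set \<Rightarrow> ((int ^ 'n) \<times> int) set" where
  "graph_over f P = (\<lambda>x. (x, f x)) ` P"

lemma card_graph_over: "card (graph_over f P) = card P"
  unfolding graph_over_def by (rule card_image) (simp add: inj_on_def)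

text \<open>
  The possible sets of pins that \<open>stuck_surface_has_dense_pins\<close> finds over the block at \<open>x\<close> when the
  surface passes through \<open>(x, y)\<close>.
\<close>

definition dense_graphs ::
  "nat \<Rightarrow> int ^ 'n::finite \<Rightarrow> int \<Rightarrow> ((int ^ 'n) \<times> int) set set" where
  "dense_graphs r x y =
     (\<lambda>(f, P). graph_over f P) `
       (block_surfaces r x y \<times>
        {P. P \<subseteq> block r x \<and> r ^ CARD('n) \<le> (4 * CARD('n) + 2) * card P})"

lemma finite_dense_graphs:
  fixes x :: "int ^ 'n::finite"
  shows "finite (dense_graphs r x y)"
    and "W \<in> dense_graphs r x y \<Longrightarrow> finite W"
proof -
  have "finite {P. P \<subseteq> block r x \<and> r ^ CARD('n) \<le> (4 * CARD('n) + 2) * card P}"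
    by (rule finite_subset[of _ "Pow (block r x)"]) (auto simp: finite_block)
  then show "finite (dense_graphs r x y)"
    unfolding dense_graphs_def by (simp add: block_surfaces_count(1))
  show "finite W" if "W \<in> dense_graphs r x y"
    using that finite_subset[OF _ finite_block[of r x]]
    unfolding dense_graphs_def graph_over_def by auto
qed

text \<open>
  Choosing a surface and its set of pinned sites costs a factor \<open>5 * 2\<close> per site of the block, and the
  set has at least \<open>r\<^sup>n / (4 n + 2)\<close> elements; \<open>p\<close> is written as \<open>b ^ (4 n + 2)\<close> to avoid fractional
  powers.
\<close>

lemma weight_dense_graphs:
  fixes x :: "int ^ 'n::finite"
  assumes "0 \<le> b" "b \<le> 1"
  shows "weight (b ^ (4 * CARD('n) + 2)) (dense_graphs r x y) \<le> (10 * b) ^ (r ^ CARD('n))"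
proof -
  let ?N = "4 * CARD('n) + 2" and ?V = "r ^ CARD('n)"
  let ?Ps = "{P. P \<subseteq> block r x \<and> ?V \<le> ?N * card P}"
  let ?I = "block_surfaces r x y \<times> ?Ps"
  have sub: "?Ps \<subseteq> Pow (block r x)"
    by auto
  have finPs: "finite ?Ps"
    by (rule finite_subset[OF sub]) (simp add: finite_block)
  then have finI: "finite ?I"
    by (simp add: block_surfaces_count(1))
  have "weight (b ^ ?N) (dense_graphs r x y)
      \<le> (\<Sum>i\<in>?I. (b ^ ?N) ^ card (case i of (f, P) \<Rightarrow> graph_over f P))"
    unfolding weight_def dense_graphs_def
    using sum_image_le[OF finI, of "\<lambda>W. (b ^ ?N) ^ card W" "\<lambda>(f, P). graph_over f P"] assms
    by (simp add: o_def)
  also have "\<dots> \<le> (\<Sum>i\<in>?I. b ^ ?V)"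
  proof (rule sum_mono)
    fix i assume "i \<in> ?I"
    then obtain f P where i: "i = (f, P)" "?V \<le> ?N * card P" by auto
    have "(b ^ ?N) ^ card P = b ^ (?N * card P)"
      by (rule power_mult[symmetric])
    also have "\<dots> \<le> b ^ ?V"
      by (rule power_decreasing) (use i assms in auto)
    finally show "(b ^ ?N) ^ card (case i of (f, P) \<Rightarrow> graph_over f P) \<le> b ^ ?V"
      by (simp only: i prod.case card_graph_over)
  qed
  also have "\<dots> = real (card (block_surfaces r x y) * card ?Ps) * b ^ ?V"
    by (simp add: card_cartesian_product)
  also have "\<dots> \<le> real (5 ^ ?V * 2 ^ ?V) * b ^ ?V"
  proof (rule mult_right_mono)
    have "card ?Ps \<le> card (Pow (block r x))"
      by (rule card_mono[OF _ sub]) (simp add: finite_block)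
    then have "card ?Ps \<le> 2 ^ ?V"
      by (simp add: card_Pow finite_block card_block)
    then show "real (card (block_surfaces r x y) * card ?Ps) \<le> real (5 ^ ?V * 2 ^ ?V)"
      unfolding of_nat_le_iff by (intro mult_mono block_surfaces_count(2)) auto
  qed (use assms in simp)
  also have "real (5 ^ ?V * 2 ^ ?V) * b ^ ?V = (5 * 2 * b) ^ ?V"
    by (simp only: power_mult_distrib of_nat_mult of_nat_power of_nat_numeral)
  finally show ?thesis by simp
qed

lemma stuck_surface_hits_dense_graphs:
  fixes x :: "int ^ 'n::finite"
  assumes lip: "lipschitz_within (nbhd R x) f"
    and stuck: "\<And>x'. x' \<in> nbhd (R - 1) x \<Longrightarrow> stuck A f x'"
    and low: "\<And>x'. x' \<in> nbhd R x \<Longrightarrow> m \<le> f x'"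
    and start: "f x < m + L"
    and size: "L + 2 * int CARD('n) * int r \<le> 2 * (R - int r)" "0 \<le> L" "4 * CARD('n) \<le> r"
  shows "hit (dense_graphs r x (f x)) A"
proof -
  let ?P = "{x' \<in> block r x. (x', f x') \<in> A}"
  let ?g = "restrict f (block r x)"
  have r: "0 < r"
    using size(3) zero_less_card_finite[where 'a='n] by linarith
  have rR: "int r \<le> R"
    by (rule side_le_radius[OF size(1,2)])
  have "block r x \<subseteq> nbhd R x"
    using block_subset_nbhd[of r x] nbhd_mono[of "int r - 1" R x] rR by auto
  then have "lipschitz_within (block r x) ?g"
    using lipschitz_within_subset[OF lip] unfolding lipschitz_within_def by auto
  then have "?g \<in> block_surfaces r x (f x)"
    unfolding block_surfaces_def using block_self[OF r, of x] by simp
  moreover have "r ^ CARD('n) \<le> (4 * CARD('n) + 2) * card ?P"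
    by (rule stuck_surface_has_dense_pins[OF lip stuck low start size])
  ultimately have "graph_over ?g ?P \<in> dense_graphs r x (f x)"
    unfolding dense_graphs_def by force
  moreover have "graph_over ?g ?P \<subseteq> A"
    unfolding graph_over_def by auto
  ultimately show ?thesis
    unfolding hit_def by blast
qed

section \<open>Blocking surfaces are unlikely\<close>

lemma power_le_geometric:
  fixes c :: real
  assumes "1 < c"
  shows "\<exists>C > 0. \<forall>t::nat. real t ^ k \<le> C * c ^ t"
proof (cases "k = 0")
  case True
  have "1 \<le> c ^ t" for t
    using assms by simp
  with True show ?thesis
    by (intro exI[of _ 1]) simp
next
  case False
  define u where "u = real k / ln c"
  have u: "0 < u"
    unfolding u_def using assms False by simp
  have "real t ^ k \<le> u ^ k * c ^ t" for t
  proof -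
    have "real t / u \<le> exp (real t / u)"
      using exp_ge_add_one_self[of "real t / u"] by linarith
    then have "(real t / u) ^ k \<le> exp (real t / u) ^ k"
      using u by (intro power_mono) auto
    also have "\<dots> = exp (real t * ln c)"
      unfolding u_def exp_of_nat_mult[symmetric] using False by (simp add: field_simps)
    also have "\<dots> = c ^ t"
      using assms by (simp add: exp_of_nat_mult)
    finally show ?thesis
      using u by (simp add: power_divide field_simps)
  qed
  then show ?thesis
    using u by (intro exI[of _ "u ^ k"]) simp
qed

lemma jump_finite_cong:
  "(\<And>e. e \<in> directions \<Longrightarrow> a e = a' e) \<Longrightarrow> jump_finite a w = jump_finite a' w"
  unfolding jump_finite_def by (simp cong: ball_cong bex_cong sum.cong)

lemma jump_cong:
  "(\<And>e. e \<in> directions \<Longrightarrow> a e = a' e) \<Longrightarrow> jump a w = jump a' w"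
  unfolding jump_def by (simp cong: bex_cong jump_finite_cong)

lemma evolve_Fin:
  assumes "S x = Fin (f x)" "\<And>e. e \<in> directions \<Longrightarrow> S (x + e) = Fin (f (x + e))"
  shows "evolve env S x = Fin (f x + jump_finite (\<lambda>e. f (x + e) - f x) (env (x, f x)))"
proof -
  have "jump (\<lambda>e. pderiv_surface e S x) (env (x, f x))
      = jump (\<lambda>e. Fin (f (x + e) - f x)) (env (x, f x))"
    by (rule jump_cong) (simp add: pderiv_surface_def assms)
  also have "\<dots> = jump_finite (\<lambda>e. f (x + e) - f x) (env (x, f x))"
    by (simp add: jump_def)
  finally show ?thesis
    by (simp add: evolve_def assms)
qed

lemma no_jump_imp_stuck:
  assumes "jump_finite (\<lambda>e. f (x + e) - f x) w = 0"
    and "(x, f x) \<notin> A \<Longrightarrow> w = ereal (1 / 2)"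
  shows "stuck A f x"
proof (cases "\<exists>e\<in>directions. f (x + e) - f x \<le> -2")
  case True
  then show ?thesis unfolding stuck_def by blast
next
  case False
  then have ge: "\<forall>e\<in>directions. f (x + e) - f x > - 2" by force
  have "\<not> (\<exists>e\<in>directions. f (x + e) - f x = 2)"
    and *: "\<not> ereal (real_of_int (\<Sum>e\<in>directions. f (x + e) - f x)) + w > 0"
    using assms(1) ge unfolding jump_finite_def by (auto simp: max_def of_bool_def split: if_splits)
  moreover have "(\<Sum>e\<in>directions. f (x + e) - f x) \<le> -1" if "(x, f x) \<notin> A"
  proof -
    have "real_of_int (\<Sum>e\<in>directions. f (x + e) - f x) + 1 / 2 \<le> 0"
      using * unfolding assms(2)[OF that] plus_ereal.simps zero_ereal_def ereal_less by simp
    then show ?thesis by linarith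
  qed
  ultimately show ?thesis
    unfolding stuck_def by blast
qed

lemma obstructed_imp_stuck:
  assumes "S x = Fin (f x)" "\<And>e. e \<in> directions \<Longrightarrow> S (x + e) = Fin (f (x + e))"
    and "obstructed env S x"
    and "(x, f x) \<notin> A \<Longrightarrow> env (x, f x) = ereal (1 / 2)"
  shows "stuck A f x"
proof (rule no_jump_imp_stuck[OF _ assms(4)])
  show "jump_finite (\<lambda>e. f (x + e) - f x) (env (x, f x)) = 0"
    using assms(1,3) evolve_Fin[of S x f env, OF assms(1,2)] unfolding obstructed_def by simp
qed

lemma finite_cube: "finite (cube l u :: (int ^ 'n::finite) set)"
  and card_cube: "card (cube l u :: (int ^ 'n) set) = nat (u - l) ^ CARD('n)"
proof -
  have eq: "cube l u = {x :: int ^ 'n. \<forall>i. x $ i \<in> {l ..< u}}"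
    unfolding cube_def by auto
  show "finite (cube l u :: (int ^ 'n) set)"
    unfolding eq by (rule card_vec_product(1)) simp
  show "card (cube l u :: (int ^ 'n) set) = nat (u - l) ^ CARD('n)"
    unfolding eq by (subst card_vec_product(2)) auto
qed

text \<open>
  The graph of a blocking surface meets the small box at some \<open>(x, y)\<close>.  The nonnegativity of the surface
  is the required lower bound, and the box of radius \<open>h L\<close> around \<open>x\<close> is wide enough because \<open>y < L\<close>.  By
  the Lipschitz bound the surface stays below \<open>H\<^sub>L\<close> there, so that it is obstructed in the original
  environment and not only in the one with \<open>-\<infinity>\<close> outside the box.
\<close>

lemma blocks_hits_dense_graphs:
  fixes \<omega> :: "(int ^ 'n::finite) \<times> int \<Rightarrow> 'w \<Rightarrow> real"
  assumes blocks: "blocks a h L (\<lambda>z. ereal (\<omega> z s)) S"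
    and height: "int L + 2 * int CARD('n) * (int h * int L) \<le> box_height a L"
    and size: "int L + 2 * int CARD('n) * int r \<le> 2 * (int h * int L - int r)" "4 * CARD('n) \<le> r"
  shows "\<exists>x \<in> cube (int h * int L) (2 * int h * int L). \<exists>y \<in> {0..<int L}.
           hit (dense_graphs r x y) (pins \<omega> s)"
proof -
  let ?C = "cube 0 (3 * int h * int L) :: (int ^ 'n) set"
  let ?R = "int h * int L"
  define f where "f x = (case S x of Fin y \<Rightarrow> y | Neg_Inf \<Rightarrow> 0)" for x
  have lip: "two_lipschitz_on ?C S"
    and pos: "\<forall>x \<in> ?C. ereal_of_zbar (S x) \<ge> 0"
    and obs: "\<forall>x \<in> ?C. ereal_of_zbar (S x) \<le> ereal (real_of_int (box_height a L)) \<longrightarrow>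
          obstructed (restrict_env (big_box a h L) (\<lambda>z. ereal (\<omega> z s))) S x"
    using blocks unfolding blocks_def by auto
  have S: "S x = Fin (f x)" if "x \<in> ?C" for x
    using lip that unfolding two_lipschitz_on_def f_def by (auto split: zbar.split)
  obtain x y where x: "x \<in> cube ?R (2 * int h * int L)" and y: "y \<in> {0..<int L}" and xy: "S x = Fin y"
    using blocks unfolding blocks_def small_box_def surface_graph_def by fast
  then have fx: "f x = y"
    unfolding f_def by simp
  have sub: "nbhd ?R x \<subseteq> ?C"
  proof
    fix x' assume x': "x' \<in> nbhd ?R x"
    have "0 \<le> x' $ i \<and> x' $ i < 3 * int h * int L" for i
    proof -
      have "\<bar>x' $ i - x $ i\<bar> \<le> ?R" "?R \<le> x $ i" "x $ i < 2 * int h * int L"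
        using x x' unfolding nbhd_def cube_def by auto
      then show ?thesis by (simp add: algebra_simps abs_le_iff)
    qed
    then show "x' \<in> ?C"
      unfolding cube_def by simp
  qed
  have lip_f: "lipschitz_within (nbhd ?R x) f"
    unfolding lipschitz_within_def
  proof (intro ballI impI)
    fix x' e assume "x' \<in> nbhd ?R x" "e \<in> directions" "x' + e \<in> nbhd ?R x"
    then have "x' \<in> ?C" "x' + e \<in> ?C" "e \<in> directions"
      using sub by auto
    then show "\<bar>f (x' + e) - f x'\<bar> \<le> 2"
      using lip S unfolding two_lipschitz_on_def by blast
  qed
  have low: "0 \<le> f x'" if "x' \<in> nbhd ?R x" for x'
    using pos S[of x'] that sub by (force simp: zero_ereal_def)
  have stuck_f: "stuck (pins \<omega> s) f x'" if x': "x' \<in> nbhd (?R - 1) x" for x'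
  proof (rule obstructed_imp_stuck)
    have x'_in: "x' \<in> nbhd ?R x"
      using x' nbhd_mono[of "?R - 1" ?R x] by auto
    then show Sx': "S x' = Fin (f x')"
      using S sub by blast
    show "S (x' + e) = Fin (f (x' + e))" if "e \<in> directions" for e
      using nbhd_trans[OF x' directions_nbhd[OF that]] S sub by auto
    have "\<bar>f x' - f x\<bar> \<le> 2 * int CARD('n) * ?R"
      by (rule lipschitz_within_nbhd[OF lip_f x'_in]) simp
    then have high: "f x' < box_height a L"
      using fx y height by auto
    then show "obstructed (restrict_env (big_box a h L) (\<lambda>z. ereal (\<omega> z s))) S x'"
      using obs x'_in sub Sx' by auto
    assume "(x', f x') \<notin> pins \<omega> s"
    then show "restrict_env (big_box a h L) (\<lambda>z. ereal (\<omega> z s)) (x', f x') = ereal (1 / 2)"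
      using high low[OF x'_in] x'_in sub unfolding pins_def restrict_env_def big_box_def by auto
  qed
  have "hit (dense_graphs r x (f x)) (pins \<omega> s)"
    by (rule stuck_surface_hits_dense_graphs[OF lip_f stuck_f low, where L = "int L"])
      (use size fx y in auto)
  then show ?thesis
    using x y fx by blast
qed

lemma zbar_countable: "countable (UNIV :: zbar set)"
proof -
  have "(UNIV :: zbar set) = insert Neg_Inf (range Fin)"
    by (auto intro: zbar.exhaust)
  then show ?thesis
    by (metis countable_insert countable_image countableI_type)
qed

lemma obstructed_cong:
  assumes "S x = S' x" "\<And>e. e \<in> directions \<Longrightarrow> S (x + e) = S' (x + e)"
  shows "obstructed env S x \<longleftrightarrow> obstructed env S' x"
proof -
  have "jump (\<lambda>e. pderiv_surface e S x) w = jump (\<lambda>e. pderiv_surface e S' x) w" for w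
    by (rule jump_cong) (simp add: pderiv_surface_def assms)
  then show ?thesis
    unfolding obstructed_def evolve_def assms(1) by (simp split: zbar.split)
qed

lemma two_lipschitz_on_cong:
  assumes "\<And>x. x \<in> D \<Longrightarrow> S x = S' x"
  shows "two_lipschitz_on D S \<longleftrightarrow> two_lipschitz_on D S'"
  unfolding two_lipschitz_on_def by (simp add: assms cong: ball_cong imp_cong)

lemma obstructed_measurable:
  fixes \<omega> :: "(int ^ 'n::finite) \<times> int \<Rightarrow> 'w \<Rightarrow> real"
  assumes [measurable]: "\<And>z. \<omega> z \<in> borel_measurable M"
  shows "Measurable.pred M (\<lambda>s. obstructed (restrict_env C (\<lambda>z. ereal (\<omega> z s))) S x)"
proof (cases "S x")
  case Neg_Inf
  then show ?thesis
    unfolding obstructed_def evolve_def by simp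
next
  case (Fin y)
  define a where "a e = (case pderiv_surface e S x of Fin u \<Rightarrow> u | Neg_Inf \<Rightarrow> 0)" for e
  have eq: "obstructed env S x \<longleftrightarrow>
      (\<exists>e\<in>directions. pderiv_surface e S x = Neg_Inf) \<or> \<not> (\<forall>e\<in>directions. a e > -2) \<or>
      (\<not> (\<exists>e\<in>directions. a e = 2) \<and> \<not> ereal (real_of_int (\<Sum>e\<in>directions. a e)) + env (x, y) > 0)"
    for env
    unfolding obstructed_def evolve_def Fin jump_def jump_finite_def a_def
    by (auto simp: of_bool_def max_def split: if_splits)
  show ?thesis
    unfolding eq restrict_env_def by measurable
qed

text \<open>
  Blocking depends on the surface only through its values on the cube and its neighbouring sites.  The
  quantifier over surfaces thus reduces to one over a countable set.
\<close>

lemma blocks_event_measurable: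
  fixes \<omega> :: "(int ^ 'n::finite) \<times> int \<Rightarrow> 'w \<Rightarrow> real"
  assumes meas: "\<And>z. \<omega> z \<in> borel_measurable M"
  shows "{s \<in> space M. \<exists>S. blocks a h L (\<lambda>z. ereal (\<omega> z s)) S} \<in> sets M"
proof -
  let ?C = "cube 0 (3 * int h * int L) :: (int ^ 'n) set"
  define D where "D = ?C \<union> (\<Union>e\<in>directions. (\<lambda>x. x + e) ` ?C)"
  have "finite D"
    unfolding D_def using finite_cube finite_directions by auto
  define \<S> where "\<S> = PiE D (\<lambda>_. UNIV :: zbar set)"
  have "countable \<S>"
    unfolding \<S>_def using \<open>finite D\<close> zbar_countable by (intro countable_PiE) auto
  have restrict: "blocks a h L env S \<longleftrightarrow> blocks a h L env (restrict S D)" for env and S :: "'n surface"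
  proof -
    have on_C: "restrict S D x = S x" if "x \<in> ?C" for x
      using that unfolding D_def by simp
    have near_C: "restrict S D (x + e) = S (x + e)" if "x \<in> ?C" "e \<in> directions" for x e
      using that unfolding D_def by auto
    have "small_box h L \<subseteq> ?C \<times> UNIV"
    proof -
      have "0 \<le> int h * int L"
        by simp
      then have "0 \<le> u \<and> u < 3 * int h * int L"
        if "int h * int L \<le> u \<and> u < 2 * int h * int L" for u
        using that by (simp add: algebra_simps)
      then show ?thesis
        unfolding small_box_def cube_def by blast
    qed
    then have "surface_graph (restrict S D) \<inter> small_box h L = surface_graph S \<inter> small_box h L"
      unfolding surface_graph_def using on_C by auto
    moreover have "two_lipschitz_on ?C (restrict S D) \<longleftrightarrow> two_lipschitz_on ?C S"
      by (rule two_lipschitz_on_cong) (rule on_C)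
    moreover have "obstructed env' (restrict S D) x \<longleftrightarrow> obstructed env' S x" if "x \<in> ?C" for env' x
      using that by (intro obstructed_cong on_C near_C)
    ultimately show ?thesis
      unfolding blocks_def using on_C by simp
  qed
  have "(\<exists>S. blocks a h L env S) \<longleftrightarrow> (\<exists>S\<in>\<S>. blocks a h L env S)" for env :: "(int ^ 'n) \<times> int \<Rightarrow> ereal"
    using restrict[of env] unfolding \<S>_def by (metis restrict_PiE_iff UNIV_I)
  then have eq: "{s \<in> space M. \<exists>S. blocks a h L (\<lambda>z. ereal (\<omega> z s)) S}
      = (\<Union>S\<in>\<S>. {s \<in> space M. blocks a h L (\<lambda>z. ereal (\<omega> z s)) S})"
    by auto
  have "{s \<in> space M. blocks a h L (\<lambda>z. ereal (\<omega> z s)) S} \<in> sets M" for S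
  proof -
    note [measurable] = obstructed_measurable[OF meas]
    have "finite ?C" by (rule finite_cube)
    then have "Measurable.pred M (\<lambda>s. blocks a h L (\<lambda>z. ereal (\<omega> z s)) S)"
      unfolding blocks_def by measurable
    then show ?thesis by simp
  qed
  then show ?thesis
    unfolding eq using \<open>countable \<S>\<close> by (intro sets.countable_UN') auto
qed

lemma bernoulli_measurable:
  assumes "bernoulli_disorder p M \<omega>"
  shows "\<omega> z \<in> borel_measurable M"
proof -
  interpret prob_space M
    using assms unfolding bernoulli_disorder_def by simp
  show ?thesis
    using assms unfolding bernoulli_disorder_def indep_vars_def by (cases z) simp
qed

lemma blocking_probability:
  fixes \<omega> :: "(int ^ 'n::finite) \<times> int \<Rightarrow> 'w \<Rightarrow> real"
  assumes ber: "bernoulli_disorder (b ^ (4 * CARD('n) + 2)) M \<omega>" and b: "0 \<le> b" "20 * b \<le> 1"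
    and "1 \<le> L"
    and height: "int L + 2 * int CARD('n) * (int h * int L) \<le> box_height a L"
    and size: "int L + 2 * int CARD('n) * int r \<le> 2 * (int h * int L - int r)" "4 * CARD('n) \<le> r"
  shows "measure M {s \<in> space M. \<exists>S. blocks a h L (\<lambda>z. ereal (\<omega> z s)) S}
    \<le> real ((h * L) ^ CARD('n) * L) * (1 / 2) ^ r"
proof -
  interpret prob_space M
    using ber unfolding bernoulli_disorder_def by simp
  let ?p = "b ^ (4 * CARD('n) + 2)"
  let ?I = "cube (int h * int L) (2 * int h * int L) \<times> {0..<int L} :: ((int ^ 'n) \<times> int) set"
  define F where "F = (\<Union>(x, y)\<in>?I. dense_graphs r x y)"
  have finI: "finite ?I"
    by (simp add: finite_cube)
  have fin: "finite F" "\<And>W. W \<in> F \<Longrightarrow> finite W"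
    unfolding F_def using finI finite_dense_graphs by auto
  have b1: "b \<le> 1" using b by linarith
  have pow: "r \<le> r ^ CARD('n)"
  proof -
    have "1 \<le> r" "CARD('n) \<noteq> 0"
      using size(2) zero_less_card_finite[where 'a='n] by linarith+
    then show ?thesis by (simp add: self_le_power)
  qed
  have "prob {s \<in> space M. \<exists>S. blocks a h L (\<lambda>z. ereal (\<omega> z s)) S}
      \<le> prob {s \<in> space M. hit F (pins \<omega> s)}"
  proof (rule finite_measure_mono[OF _ bernoulli_hit(1)[OF ber fin]])
    show "{s \<in> space M. \<exists>S. blocks a h L (\<lambda>z. ereal (\<omega> z s)) S} \<subseteq> {s \<in> space M. hit F (pins \<omega> s)}"
    proof
      fix s assume "s \<in> {s \<in> space M. \<exists>S. blocks a h L (\<lambda>z. ereal (\<omega> z s)) S}"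
      then obtain S where s: "s \<in> space M" and "blocks a h L (\<lambda>z. ereal (\<omega> z s)) S"
        by auto
      from blocks_hits_dense_graphs[where \<omega> = \<omega> and s = s, OF this(2) height size]
      obtain x y where "(x, y) \<in> ?I" "hit (dense_graphs r x y) (pins \<omega> s)"
        by auto
      then have "hit F (pins \<omega> s)"
        unfolding F_def hit_def by blast
      with s show "s \<in> {s \<in> space M. hit F (pins \<omega> s)}" by simp
    qed
  qed
  also have "\<dots> \<le> weight ?p F"
    by (rule bernoulli_hit(2)[OF ber fin])
  also have "\<dots> \<le> (\<Sum>i\<in>?I. weight ?p (case i of (x, y) \<Rightarrow> dense_graphs r x y))"
    unfolding F_def by (rule weight_UN) (use b finI finite_dense_graphs in \<open>auto\<close>)
  also have "\<dots> \<le> (\<Sum>i\<in>?I. (1 / 2) ^ r)"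
  proof (rule sum_mono)
    fix i :: "(int ^ 'n) \<times> int"
    obtain x y where i: "i = (x, y)" by fastforce
    have "weight ?p (dense_graphs r x y) \<le> (10 * b) ^ (r ^ CARD('n))"
      by (rule weight_dense_graphs[OF b(1) b1])
    also have "\<dots> \<le> (1 / 2) ^ (r ^ CARD('n))"
      by (rule power_mono) (use b in auto)
    also have "\<dots> \<le> (1 / 2) ^ r"
      by (rule power_decreasing[OF pow]) auto
    finally show "weight ?p (case i of (x, y) \<Rightarrow> dense_graphs r x y) \<le> (1 / 2) ^ r"
      unfolding i by simp
  qed
  also have "\<dots> = real ((h * L) ^ CARD('n) * L) * (1 / 2) ^ r"
  proof -
    have "2 * int h * int L - int h * int L = int (h * L)"
      by simp
    then have "card ?I = (h * L) ^ CARD('n) * L"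
      by (simp only: card_cartesian_product card_cube nat_int card_atLeastLessThan_int diff_zero)
    then show ?thesis by simp
  qed
  finally show ?thesis .
qed

lemma finite_size_criterion:
  fixes \<omega> :: "(int ^ 'n::finite) \<times> int \<Rightarrow> 'w \<Rightarrow> real"
  assumes ber: "bernoulli_disorder (b ^ (4 * CARD('n) + 2)) M \<omega>" and b: "0 \<le> b" "20 * b \<le> 1"
    and "1 \<le> a" "10 \<le> h"
  shows "\<exists>c > 0. \<forall>L::nat. real L \<ge> c \<longrightarrow>
    measure M {s \<in> space M. \<exists>S. blocks a h L (\<lambda>z. ereal (\<omega> z s)) S} \<le> real L powr (- 1)"
proof -
  let ?n = "CARD('n)"
  have n: "1 \<le> ?n"
    using zero_less_card_finite[where 'a='n] by linarith
  obtain C where C: "C > 0" "\<And>t. real t ^ (?n + 2) \<le> C * (3 / 2) ^ t"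
    using power_le_geometric[of "3 / 2" "?n + 2"] by auto
  define B where "B = real h ^ ?n * real ?n ^ (?n + 2) * C * (3 / 2)"
  have B: "0 \<le> B"
    unfolding B_def using C by simp
  obtain t0 where t0: "(3 / 4 :: real) ^ t0 < 1 / (B + 1)"
    using real_arch_pow_inv[of "1 / (B + 1)" "3 / 4"] B by auto
  (* The summands make L div n at least t0 and 4 n, and make L * L exceed the heights that a
  surface starting below L can reach in the cube. *)
  define c where "c = ?n * (t0 + 1) + 4 * ?n * ?n + 2 * ?n * h + 1"
  have main: "measure M {s \<in> space M. \<exists>S. blocks a h L (\<lambda>z. ereal (\<omega> z s)) S} \<le> real L powr (- 1)"
    if "c \<le> L" for L
  proof -
    have L: "1 \<le> L" "?n * (t0 + 1) \<le> L" "4 * ?n * ?n \<le> L" "2 * ?n * h + 1 \<le> L"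
      using that unfolding c_def by auto
    (* For this side L + (2 n + 2) r is at most 5 L, well within the 2 h L available. *)
    define r where "r = L div ?n"
    have rn: "?n * r \<le> L" "L \<le> ?n * (r + 1)"
      unfolding r_def using n dividend_less_times_div[of ?n L] by auto
    have r4: "4 * ?n \<le> r" "t0 \<le> r"
      unfolding r_def using L n by (auto simp: less_eq_div_iff_mult_less_eq mult.commute)
    have rL: "r \<le> L"
      unfolding r_def by simp
    have height: "int L + 2 * int ?n * (int h * int L) \<le> box_height a L"
    proof -
      have "L + 2 * ?n * (h * L) = (2 * ?n * h + 1) * L"
        by (simp add: algebra_simps)
      also have "\<dots> \<le> L * L"
        using L by (intro mult_right_mono) auto
      also have "\<dots> = L ^ 2"
        by (simp add: power2_eq_square)
      also have "\<dots> \<le> L ^ (a + 1)"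
        using L assms by (intro power_increasing) auto
      finally have "int (L + 2 * ?n * (h * L)) \<le> int (L ^ (a + 1))"
        by (simp only: of_nat_le_iff)
      then show ?thesis
        unfolding box_height_def by simp
    qed
    have size: "int L + 2 * int ?n * int r \<le> 2 * (int h * int L - int r)"
    proof -
      have "L + 2 * (?n * r) + 2 * r \<le> 2 * (10 * L)"
        using rn rL by linarith
      also have "\<dots> \<le> 2 * (h * L)"
        using assms by (intro mult_left_mono mult_right_mono) auto
      finally have "int (L + 2 * (?n * r) + 2 * r) \<le> int (2 * (h * L))"
        by (simp only: of_nat_le_iff)
      then show ?thesis
        by (simp add: algebra_simps)
    qed
    have "real ((h * L) ^ ?n * L) * real L \<le> real h ^ ?n * real (?n * (r + 1)) ^ (?n + 2)"
    proof -
      have "real ((h * L) ^ ?n * L) * real L = real h ^ ?n * real L ^ (?n + 2)"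
        by (simp add: power_mult_distrib power_add power2_eq_square)
      also have "\<dots> \<le> real h ^ ?n * real (?n * (r + 1)) ^ (?n + 2)"
      proof (intro mult_left_mono power_mono)
        show "real L \<le> real (?n * (r + 1))"
          using rn(2) by (simp only: of_nat_le_iff)
      qed simp_all
      finally show ?thesis .
    qed
    also have "\<dots> = real h ^ ?n * real ?n ^ (?n + 2) * real (r + 1) ^ (?n + 2)"
      by (simp only: of_nat_mult power_mult_distrib mult.assoc)
    also have "\<dots> \<le> real h ^ ?n * real ?n ^ (?n + 2) * (C * (3 / 2) ^ (r + 1))"
      by (intro mult_left_mono C(2)) simp
    also have "\<dots> = B * (3 / 2) ^ r"
      unfolding B_def by simp
    finally have poly: "real ((h * L) ^ ?n * L) * real L \<le> B * (3 / 2) ^ r" .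
    have "real ((h * L) ^ ?n * L) * (1 / 2) ^ r * real L \<le> B * (3 / 2) ^ r * (1 / 2) ^ r"
      using mult_right_mono[OF poly, of "(1 / 2) ^ r"] by (simp add: mult.commute mult.left_commute)
    also have "\<dots> = B * (3 / 4) ^ r"
      by (simp add: power_mult_distrib[symmetric])
    also have "\<dots> \<le> B * (3 / 4) ^ t0"
      using B r4 by (intro mult_left_mono power_decreasing) auto
    also have "\<dots> \<le> B * (1 / (B + 1))"
      using B t0 by (intro mult_left_mono) auto
    also have "\<dots> \<le> 1"
      using B by (simp add: field_simps)
    finally have "real ((h * L) ^ ?n * L) * (1 / 2) ^ r \<le> 1 / real L"
      using L by (simp add: field_simps)
    moreover have "real L powr (- 1) = 1 / real L"
      using L(1) by (simp add: powr_minus divide_inverse)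
    ultimately show ?thesis
      using blocking_probability[OF ber b L(1) height size r4(1)] by linarith
  qed
  show ?thesis
  proof (intro exI[of _ "real c"] conjI allI impI main)
    show "0 < real c" unfolding c_def of_nat_0_less_iff by simp
  qed simp
qed

section \<open>Evolutions and their backward chains\<close>

text \<open>
  What the speed estimate uses of the dynamics: heights are 2-Lipschitz, grow by at most one per step,
  and fail to grow only where the surface is stuck.
\<close>

definition pinned_evolution ::
  "((int ^ 'n) \<times> int) set \<Rightarrow> (nat \<Rightarrow> int ^ 'n::finite \<Rightarrow> int) \<Rightarrow> bool" where
  "pinned_evolution A u \<longleftrightarrow>
     (\<forall>t. lipschitz_within UNIV (u t)) \<and>
     (\<forall>t x. u (Suc t) x = u t x + 1 \<or> u (Suc t) x = u t x \<and> stuck A (u t) x)"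

lemma pinned_evolution_mono:
  assumes "pinned_evolution A u" "s \<le> t"
  shows "u s x \<le> u t x"
proof (rule lift_Suc_mono_le[OF _ assms(2)])
  show "u t x \<le> u (Suc t) x" for t
    using assms(1) unfolding pinned_evolution_def by (smt (verit))
qed

text \<open>
  Witnesses for the slowness of a surface passing through \<open>z\<close>.  When the surface comes to rest it may
  still be below \<open>z\<close>, by less than \<open>k\<close>.
\<close>

definition stall :: "nat \<Rightarrow> (int ^ 'n::finite) \<times> int \<Rightarrow> ((int ^ 'n) \<times> int) set set" where
  "stall k z = (\<Union>y\<in>{snd z - int k <.. snd z}. dense_graphs k (fst z) y)"

text \<open>
  The number of sites in a box of radius \<open>R = (n + 2) k\<close> times \<open>2 n R + k\<close>.  A site of the box ends at
  most \<open>2 n R\<close> above the centre, so if it started less than \<open>k\<close> below the final height of the centre, it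
  made fewer than \<open>2 n R + k\<close> moves.
\<close>

definition stall_time :: "nat \<Rightarrow> nat \<Rightarrow> nat" where
  "stall_time n k = (2 * ((n + 2) * k) + 1) ^ n * (2 * n * ((n + 2) * k) + k)"

text \<open>
  The displacement is bounded by a multiple of the actual drop, rather than of \<open>k\<close>, so that the bounds
  add up along a chain of descents.
\<close>

definition descends ::
  "(nat \<Rightarrow> int ^ 'n::finite \<Rightarrow> int) \<Rightarrow> nat \<Rightarrow> nat \<Rightarrow> nat \<Rightarrow> int ^ 'n \<Rightarrow> bool" where
  "descends u t \<tau> k x \<longleftrightarrow>
     (\<exists>x'. u (t - \<tau>) x' \<le> u t x - int k \<and>
           x' \<in> nbhd ((int CARD('n) + 2) * (u t x - u (t - \<tau>) x')) x)"

text \<open>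
  If no site of the box was lower by \<open>k\<close>, then the sum of the heights over the box increases by less
  than the length of the time window.  At some time in it nothing moves, and the surface at that time
  contains a dense graph.
\<close>

lemma descends_if_no_stall:
  fixes u :: "nat \<Rightarrow> int ^ 'n::finite \<Rightarrow> int"
  assumes evo: "pinned_evolution A u" and k: "4 * CARD('n) \<le> k"
    and t: "stall_time CARD('n) k \<le> t" and no_stall: "\<not> hit (stall k (x, u t x)) A"
  shows "descends u t (stall_time CARD('n) k) k x"
proof (rule ccontr)
  let ?n = "CARD('n)"
  let ?T = "stall_time ?n k"
  define R where "R = (?n + 2) * k"
  let ?D = "nbhd (int R) x"
  assume contra: "\<not> descends u t ?T k x"
  have start: "u (t - ?T) x' > u t x - int k" if x': "x' \<in> ?D" for x'
  proof (rule ccontr)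
    assume "\<not> ?thesis"
    then have drop: "u (t - ?T) x' \<le> u t x - int k" by simp
    have "int R = (int ?n + 2) * int k"
      unfolding R_def by (simp add: algebra_simps)
    also have "\<dots> \<le> (int ?n + 2) * (u t x - u (t - ?T) x')"
      using drop by (intro mult_left_mono) auto
    finally have "x' \<in> nbhd ((int ?n + 2) * (u t x - u (t - ?T) x')) x"
      using x' nbhd_mono by blast
    with drop contra show False
      unfolding descends_def by blast
  qed
  have lip: "lipschitz_within (nbhd (int R) x) (u s)" for s
    using evo lipschitz_within_subset unfolding pinned_evolution_def by blast
  have finD: "finite ?D"
    by (rule finite_nbhd)
  have cardD: "card ?D = (2 * R + 1) ^ ?n"
    by (simp add: card_nbhd nat_add_distrib nat_mult_distrib)
  have T_eq: "?T = card ?D * (2 * ?n * R + k)"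
    unfolding cardD unfolding stall_time_def R_def ..
  have "\<exists>s. t - ?T \<le> s \<and> s < t \<and> (\<forall>x'\<in>?D. u (Suc s) x' = u s x')"
  proof (rule ccontr)
    assume "\<not> ?thesis"
    then have busy: "\<exists>x'\<in>?D. u (Suc s) x' \<noteq> u s x'" if "t - ?T \<le> s" "s < t" for s
      using that by blast
    have inc: "sum (u s) ?D + 1 \<le> sum (u (Suc s)) ?D" if s: "t - ?T \<le> s" "s < t" for s
    proof -
      have "sum (u s) ?D < sum (u (Suc s)) ?D"
      proof (rule sum_strict_mono_ex1[OF finD])
        show "\<forall>x'\<in>?D. u s x' \<le> u (Suc s) x'"
          using pinned_evolution_mono[OF evo, of s "Suc s"] by simp
        show "\<exists>x'\<in>?D. u s x' < u (Suc s) x'"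
          using busy[OF s] pinned_evolution_mono[OF evo, of s "Suc s"] by (force simp: order_less_le)
      qed
      then show ?thesis by simp
    qed
    have "i \<le> ?T \<Longrightarrow> sum (u (t - ?T)) ?D + int i \<le> sum (u (t - ?T + i)) ?D" for i
    proof (induction i)
      case 0
      then show ?case by simp
    next
      case (Suc i)
      have "t - ?T + i < t"
        using Suc.prems t by linarith
      then have "sum (u (t - ?T + i)) ?D + 1 \<le> sum (u (t - ?T + Suc i)) ?D"
        using inc[of "t - ?T + i"] by simp
      moreover have "sum (u (t - ?T)) ?D + int i \<le> sum (u (t - ?T + i)) ?D"
        using Suc by simp
      ultimately show ?case by simp
    qed
    from this[of ?T] have "int ?T \<le> sum (u t) ?D - sum (u (t - ?T)) ?D"
      using t by simp
    also have "\<dots> = (\<Sum>x'\<in>?D. u t x' - u (t - ?T) x')"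
      by (rule sum_subtractf[symmetric])
    also have "\<dots> \<le> (\<Sum>x'\<in>?D. int (2 * ?n * R + k) - 1)"
    proof (rule sum_mono)
      fix x' assume x': "x' \<in> ?D"
      have "\<bar>u t x' - u t x\<bar> \<le> 2 * int ?n * int R"
        by (rule lipschitz_within_nbhd[OF lip x']) simp
      then show "u t x' - u (t - ?T) x' \<le> int (2 * ?n * R + k) - 1"
        using start[OF x'] by simp
    qed
    also have "\<dots> = int (card ?D) * (int (2 * ?n * R + k) - 1)"
      by simp
    also have "\<dots> < int (card ?D) * int (2 * ?n * R + k)"
    proof -
      have "0 < card ?D"
        unfolding cardD by simp
      then show ?thesis
        by (intro mult_strict_left_mono) auto
    qed
    also have "\<dots> = int ?T"
      unfolding T_eq by (simp only: of_nat_mult)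
    finally show False by simp
  qed
  then obtain s where s: "t - ?T \<le> s" "s < t" and still: "\<And>x'. x' \<in> ?D \<Longrightarrow> u (Suc s) x' = u s x'"
    by blast
  have low: "u t x - int k + 1 \<le> u s x'" if "x' \<in> ?D" for x'
    using start[OF that] pinned_evolution_mono[OF evo s(1), of x'] by simp
  have high: "u s x \<le> u t x"
    using pinned_evolution_mono[OF evo] s(2) by simp
  have stuck_s: "stuck A (u s) x'" if "x' \<in> nbhd (int R - 1) x" for x'
  proof -
    have "x' \<in> ?D"
      using that nbhd_mono[of "int R - 1" "int R" x] by auto
    then have "u (Suc s) x' = u s x'"
      by (rule still)
    then show ?thesis
      using evo unfolding pinned_evolution_def by (metis add_cancel_left_right zero_neq_one)
  qed
  have "hit (dense_graphs k x (u s x)) A"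
  proof (rule stuck_surface_hits_dense_graphs[OF lip stuck_s low])
    show "u s x < u t x - int k + 1 + int k"
      using high by simp
    (* This inequality is the reason for the factor n + 2 in R. *)
    show "int k + 2 * int ?n * int k \<le> 2 * (int R - int k)"
      unfolding R_def by (simp add: algebra_simps)
  qed (use k in auto)
  moreover have "u s x \<in> {u t x - int k <.. u t x}"
    using low[OF nbhd_self] high by simp
  ultimately show False
    using no_stall unfolding stall_def hit_def by auto
qed

lemma descends_mono:
  fixes u :: "nat \<Rightarrow> int ^ 'n::finite \<Rightarrow> int"
  assumes evo: "pinned_evolution A u" and "descends u t \<tau> k x" and "\<tau> \<le> \<tau>'"
  shows "descends u t \<tau>' k x"
proof -
  let ?M = "int CARD('n) + 2"
  obtain x' where x': "u (t - \<tau>) x' \<le> u t x - int k" "x' \<in> nbhd (?M * (u t x - u (t - \<tau>) x')) x"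
    using assms(2) unfolding descends_def by blast
  have le: "u (t - \<tau>') x' \<le> u (t - \<tau>) x'"
    using pinned_evolution_mono[OF evo] assms(3) by (simp add: diff_le_mono2)
  then have "nbhd (?M * (u t x - u (t - \<tau>) x')) x \<subseteq> nbhd (?M * (u t x - u (t - \<tau>') x')) x"
    by (intro nbhd_mono mult_left_mono) auto
  with x' le show ?thesis
    unfolding descends_def by (smt (verit) subsetD)
qed

section \<open>The multi-level_size hierarchy of bad sites\<close>

definition level_size :: "nat \<Rightarrow> nat \<Rightarrow> nat" where
  "level_size K j = K ^ 2 ^ j"

lemma level_size_0: "level_size K 0 = K"
  and level_size_Suc: "level_size K (Suc j) = level_size K j * level_size K j"
  unfolding level_size_def by (auto simp: power_add mult_2)

lemma level_size_ge: "1 \<le> K \<Longrightarrow> K \<le> level_size K j"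
  unfolding level_size_def by (cases "K = 0") (auto simp: self_le_power)

lemma stall_level_le: 
  assumes "2 \<le> K"
  shows "K * 2 ^ j \<le> level_size K j"
proof (induction j)
  case 0
  then show ?case by (simp add: level_size_0)
next
  case (Suc j)
  have "K * 2 ^ Suc j = (K * 2 ^ j) * 2" by simp
  also have "\<dots> \<le> level_size K j * level_size K j"
    using Suc level_size_ge[of K j] assms by (intro mult_mono) auto
  finally show ?case
    by (simp add: level_size_Suc)
qed

definition zball :: "int \<Rightarrow> (int ^ 'n::finite) \<times> int \<Rightarrow> ((int ^ 'n) \<times> int) set" where
  "zball r z = nbhd r (fst z) \<times> {snd z - r .. snd z + r}"

lemma finite_zball: "finite (zball r z)"
  unfolding zball_def by (simp add: finite_nbhd)

lemma card_zball:
  "card (zball (int r) (z :: (int ^ 'n::finite) \<times> int)) = (2 * r + 1) ^ (CARD('n) + 1)"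
  unfolding zball_def card_cartesian_product card_nbhd
  by (simp add: nat_add_distrib nat_mult_distrib)

lemma zball_mono: "r \<le> s \<Longrightarrow> zball r z \<subseteq> zball s z"
  unfolding zball_def using nbhd_mono by (auto; fastforce)

lemma zball_trans: "z' \<in> zball r z \<Longrightarrow> z'' \<in> zball s z' \<Longrightarrow> z'' \<in> zball (r + s) z"
  unfolding zball_def using nbhd_trans by fastforce

lemma zball_sym: "z' \<in> zball r z \<longleftrightarrow> z \<in> zball r z'"
  unfolding zball_def nbhd_def by (cases z; cases z') (auto simp: abs_minus_commute)

definition bad_triples ::
  "nat \<Rightarrow> nat \<Rightarrow> (int ^ 'n::finite) \<times> int \<Rightarrow>
     (((int ^ 'n) \<times> int) \<times> ((int ^ 'n) \<times> int) \<times> ((int ^ 'n) \<times> int)) set" where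
  "bad_triples r \<rho> z =
     {(z1, z2, z3). z1 \<in> zball (int r) z \<and> z2 \<in> zball (int r) z \<and> z3 \<in> zball (int r) z \<and>
        z2 \<notin> zball (int \<rho>) z1 \<and> z3 \<notin> zball (int \<rho>) z1 \<and> z3 \<notin> zball (int \<rho>) z2}"

text \<open>
  The triples are three far apart, not two, since with \<open>L\<^sub>j\<^sub>+\<^sub>1 = L\<^sub>j\<^sup>2\<close> the probability must improve to
  more than its square to compensate for the number of positions.  The distance \<open>6 (n + 2) L\<^sub>j\<close> is
  twice the radius in \<open>bad_support\<close>.
\<close>

primrec bad :: "nat \<Rightarrow> nat \<Rightarrow> (int ^ 'n::finite) \<times> int \<Rightarrow> ((int ^ 'n) \<times> int) set set" where
  "bad K 0 z = stall K z"
| "bad K (Suc j) z =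
     (\<Union>z'\<in>zball (int ((CARD('n) + 2) * level_size K (Suc j))) z. stall (K * 2 ^ j) z') \<union>
     (\<Union>(z1, z2, z3)\<in>bad_triples ((CARD('n) + 2) * level_size K (Suc j)) (6 * (CARD('n) + 2) * level_size K j) z.
        (\<lambda>(W1, W2, W3). W1 \<union> W2 \<union> W3) ` (bad K j z1 \<times> bad K j z2 \<times> bad K j z3))"

lemma bad_Suc_stall:
  fixes z :: "(int ^ 'n::finite) \<times> int"
  assumes "z' \<in> zball (int ((CARD('n) + 2) * level_size K (Suc j))) z" "W \<in> stall (K * 2 ^ j) z'"
  shows "W \<in> bad K (Suc j) z"
  unfolding bad.simps using assms by (intro UnI1 UN_I)

lemma bad_Suc_triple:
  fixes z :: "(int ^ 'n::finite) \<times> int"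
  assumes tri: "(z1, z2, z3) \<in>
      bad_triples ((CARD('n) + 2) * level_size K (Suc j)) (6 * (CARD('n) + 2) * level_size K j) z"
    and "W1 \<in> bad K j z1" "W2 \<in> bad K j z2" "W3 \<in> bad K j z3"
  shows "W1 \<union> W2 \<union> W3 \<in> bad K (Suc j) z"
proof -
  have "W1 \<union> W2 \<union> W3 \<in>
      (\<lambda>(W1, W2, W3). W1 \<union> W2 \<union> W3) ` (bad K j z1 \<times> bad K j z2 \<times> bad K j z3)"
    by (rule image_eqI[of _ _ "(W1, W2, W3)"]) (use assms in auto)
  then show ?thesis
    unfolding bad.simps using tri by (intro UnI2 UN_I[of "(z1, z2, z3)"]) auto
qed

lemma finite_stall:
  shows "finite (stall k z)" and "W \<in> stall k z \<Longrightarrow> finite W"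
  unfolding stall_def using finite_dense_graphs by auto

lemma finite_bad_triples: "finite (bad_triples r \<rho> z)"
  by (rule finite_subset[of _ "zball (int r) z \<times> zball (int r) z \<times> zball (int r) z"])
    (auto simp: bad_triples_def finite_zball)

lemma finite_bad:
  shows "finite (bad K j z)" and "W \<in> bad K j z \<Longrightarrow> finite W"
proof -
  have "finite (bad K j z) \<and> (\<forall>W\<in>bad K j z. finite W)"
    by (induction j arbitrary: z)
      (auto simp: finite_stall finite_zball finite_bad_triples)
  then show "finite (bad K j z)" and "W \<in> bad K j z \<Longrightarrow> finite W"
    by auto
qed

lemma stall_support:
  fixes z :: "(int ^ 'n::finite) \<times> int"
  assumes "W \<in> stall k z"
  shows "W \<subseteq> zball (int ((2 * CARD('n) + 1) * k)) z"
proof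
  fix v assume v: "v \<in> W"
  obtain y where y: "snd z - int k < y" "y \<le> snd z" and W: "W \<in> dense_graphs k (fst z) y"
    using assms unfolding stall_def by auto
  then obtain f P where f: "f \<in> block_surfaces k (fst z) y" and P: "P \<subseteq> block k (fst z)"
    and eq: "W = graph_over f P"
    unfolding dense_graphs_def by auto
  obtain x where x: "x \<in> block k (fst z)" and v_eq: "v = (x, f x)"
    using v P unfolding eq graph_over_def by auto
  have "\<bar>f x - y\<bar> \<le> 2 * int CARD('n) * int k"
    using f lipschitz_within_block[OF _ x, of f] unfolding block_surfaces_def by auto
  then have "\<bar>f x - snd z\<bar> \<le> int ((2 * CARD('n) + 1) * k)"
    using y by (simp add: algebra_simps)
  moreover have "x \<in> nbhd (int ((2 * CARD('n) + 1) * k)) (fst z)"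
  proof -
    have "int k - 1 \<le> int ((2 * CARD('n) + 1) * k)"
      by (simp add: algebra_simps)
    then show ?thesis
      using x block_subset_nbhd nbhd_mono by blast
  qed
  ultimately show "v \<in> zball (int ((2 * CARD('n) + 1) * k)) z"
    unfolding zball_def v_eq by auto
qed

lemma bad_support:
  fixes z :: "(int ^ 'n::finite) \<times> int"
  assumes K: "2 \<le> K"
  shows "W \<in> bad K j z \<Longrightarrow> W \<subseteq> zball (int (3 * (CARD('n) + 2) * level_size K j)) z"
proof (induction j arbitrary: z W)
  case 0
  have "W \<subseteq> zball (int ((2 * CARD('n) + 1) * K)) z"
    using 0 by (intro stall_support) simp
  also have "\<dots> \<subseteq> zball (int (3 * (CARD('n) + 2) * level_size K 0)) z"
    by (intro zball_mono) (simp only: level_size_0 of_nat_le_iff, intro mult_right_mono, auto)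
  finally show ?case .
next
  case (Suc j)
  let ?M = "CARD('n) + 2" and ?L = "level_size K j"
  have L: "2 \<le> ?L"
    using level_size_ge[of K j] K by linarith
  have sum: "?M * level_size K (Suc j) + 3 * ?M * ?L \<le> 3 * ?M * level_size K (Suc j)"
  proof -
    have "3 * ?L \<le> 2 * (?L * ?L)"
      using mult_right_mono[OF L, of ?L] L by linarith
    then have "?M * (3 * ?L) \<le> ?M * (2 * (?L * ?L))"
      by (intro mult_left_mono) auto
    then show ?thesis
      unfolding level_size_Suc by (simp add: algebra_simps)
  qed
  have enlarge: "zball (int (3 * ?M * ?L)) z' \<subseteq> zball (int (3 * ?M * level_size K (Suc j))) z"
    if "z' \<in> zball (int (?M * level_size K (Suc j))) z" for z'
  proof
    fix v assume "v \<in> zball (int (3 * ?M * ?L)) z'"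
    then have "v \<in> zball (int (?M * level_size K (Suc j)) + int (3 * ?M * ?L)) z"
      by (rule zball_trans[OF that])
    also have "\<dots> \<subseteq> zball (int (3 * ?M * level_size K (Suc j))) z"
      by (intro zball_mono) (simp only: sum of_nat_le_iff flip: of_nat_add)
    finally show "v \<in> zball (int (3 * ?M * level_size K (Suc j))) z" .
  qed
  consider z' where "z' \<in> zball (int (?M * level_size K (Suc j))) z" "W \<in> stall (K * 2 ^ j) z'"
    | z1 z2 z3 W1 W2 W3 where
      "(z1, z2, z3) \<in> bad_triples (?M * level_size K (Suc j)) (6 * ?M * ?L) z"
      "W1 \<in> bad K j z1" "W2 \<in> bad K j z2" "W3 \<in> bad K j z3" "W = W1 \<union> W2 \<union> W3"
    using Suc.prems unfolding bad.simps by blast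
  then show ?case
  proof cases
    case 1
    have "(2 * CARD('n) + 1) * (K * 2 ^ j) \<le> 3 * ?M * ?L"
      by (intro mult_mono stall_level_le[OF K]) auto
    then have "zball (int ((2 * CARD('n) + 1) * (K * 2 ^ j))) z' \<subseteq> zball (int (3 * ?M * ?L)) z'"
      by (intro zball_mono) (simp only: of_nat_le_iff)
    then show ?thesis
      using stall_support[OF 1(2)] enlarge[OF 1(1)] by blast
  next
    case 2
    then have "z1 \<in> zball (int (?M * level_size K (Suc j))) z" "z2 \<in> zball (int (?M * level_size K (Suc j))) z"
      "z3 \<in> zball (int (?M * level_size K (Suc j))) z"
      unfolding bad_triples_def by auto
    then show ?thesis
      using Suc.IH[OF 2(2)] Suc.IH[OF 2(3)] Suc.IH[OF 2(4)] enlarge 2(5) by blast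
  qed
qed

lemma far_balls_disjoint:
  assumes "z' \<notin> zball (2 * r) z"
  shows "zball r z \<inter> zball r z' = {}"
proof (rule ccontr)
  assume "\<not> ?thesis"
  then obtain v where "v \<in> zball r z" "v \<in> zball r z'" by auto
  then have "z' \<in> zball (r + r) z"
    using zball_trans zball_sym by blast
  with assms show False by simp
qed

text \<open>
  A maximal set of mutually far bad sites has at most two elements, and every bad site is close to one
  of them.
\<close>

lemma bad_heights_card:
  fixes z :: "(int ^ 'n::finite) \<times> int"
  defines "\<rho> \<equiv> \<lambda>K j. 6 * (CARD('n) + 2) * level_size K j"
  assumes ok: "\<not> hit (bad K (Suc j) z) A"
  shows "card (snd ` {z' \<in> zball (int ((CARD('n) + 2) * level_size K (Suc j))) z. hit (bad K j z') A})
    \<le> 2 * (2 * \<rho> K j + 1)"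
proof -
  let ?Z = "zball (int ((CARD('n) + 2) * level_size K (Suc j))) z"
  let ?B = "{z' \<in> ?Z. hit (bad K j z') A}"
  let ?\<rho> = "int (\<rho> K j)"
  let ?I = "\<lambda>z' :: (int ^ 'n) \<times> int. {snd z' - ?\<rho> .. snd z' + ?\<rho>}"
  have "\<exists>a b. snd ` ?B \<subseteq> ?I a \<union> ?I b"
  proof (cases "\<exists>z1\<in>?B. \<exists>z2\<in>?B. z2 \<notin> zball ?\<rho> z1")
    case True
    then obtain z1 z2 where z12: "z1 \<in> ?B" "z2 \<in> ?B" "z2 \<notin> zball ?\<rho> z1" by blast
    have "snd z3 \<in> ?I z1 \<union> ?I z2" if z3: "z3 \<in> ?B" for z3
    proof (rule ccontr)
      assume far: "\<not> ?thesis"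
      then have "z3 \<notin> zball ?\<rho> z1" "z3 \<notin> zball ?\<rho> z2"
        unfolding zball_def by auto
      then have tri: "(z1, z2, z3) \<in> bad_triples ((CARD('n) + 2) * level_size K (Suc j)) (\<rho> K j) z"
        using z12 z3 unfolding bad_triples_def by auto
      obtain W1 W2 W3 where "W1 \<in> bad K j z1" "W2 \<in> bad K j z2" "W3 \<in> bad K j z3"
        and sub: "W1 \<subseteq> A" "W2 \<subseteq> A" "W3 \<subseteq> A"
        using z12 z3 unfolding hit_def by auto
      from this(1-3) have "W1 \<union> W2 \<union> W3 \<in> bad K (Suc j) z"
        by (rule bad_Suc_triple[OF tri[unfolded \<rho>_def]])
      moreover have "W1 \<union> W2 \<union> W3 \<subseteq> A"
        using sub by simp
      ultimately show False
        using ok unfolding hit_def by (meson bexI)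
    qed
    then show ?thesis by blast
  next
    case False
    show ?thesis
    proof (cases "?B = {}")
      case True
      then show ?thesis by (simp only: image_empty) blast
    next
      case nonempty: False
      then obtain z1 where z1: "z1 \<in> ?B" by blast
      have "snd ` ?B \<subseteq> ?I z1 \<union> ?I z1"
      proof
        fix h assume "h \<in> snd ` ?B"
        then obtain z2 where "z2 \<in> ?B" "h = snd z2" by blast
        moreover from this have "z2 \<in> zball ?\<rho> z1"
          using False z1 by blast
        ultimately show "h \<in> ?I z1 \<union> ?I z1"
          unfolding zball_def by auto
      qed
      then show ?thesis by blast
    qed
  qed
  then obtain a b where "snd ` ?B \<subseteq> ?I a \<union> ?I b" by blast
  then have "card (snd ` ?B) \<le> card (?I a \<union> ?I b)"
    by (intro card_mono) auto
  also have "\<dots> \<le> card (?I a) + card (?I b)"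
    by (rule card_Un_le)
  also have "\<dots> = 2 * (2 * \<rho> K j + 1)"
    by (simp add: nat_add_distrib nat_mult_distrib)
  finally show ?thesis .
qed

text \<open>
  At level \<open>j + 1\<close> there are at most \<open>L\<^sub>j\<close> descents of level \<open>j\<close>, and a slow step for each height of the
  bad sites counted in \<open>bad_heights_card\<close>.
\<close>

primrec descent_time :: "nat \<Rightarrow> nat \<Rightarrow> nat \<Rightarrow> nat" where
  "descent_time n K 0 = stall_time n K"
| "descent_time n K (Suc j) =
     level_size K j * descent_time n K j + 2 * (2 * (6 * (n + 2) * level_size K j) + 1) * stall_time n (K * 2 ^ j)"

text \<open>One step of the chain, at a site that is good at level_size \<open>j\<close> or else at a bad one.\<close>

text \<open>
  The induction behind a descent by \<open>H\<close> from \<open>(x, y)\<close>.  At a point outside \<open>B\<close> the chain takes time \<open>\<tau>\<close>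
  to drop by \<open>L\<close>, which uses up one of the \<open>q\<close> units of height; at a point of \<open>B\<close> it takes time \<open>T\<close> and
  leaves for good one of the heights at which \<open>B\<close> is present.  The time still needed is therefore
  \<open>q \<tau>\<close> plus \<open>T\<close> times the number of such heights not above the current point.  The region \<open>Z\<close>
  contains every point that the chain can reach before it has dropped by \<open>H\<close>.
\<close>

lemma chain_at_next_level:
  fixes u :: "nat \<Rightarrow> int ^ 'n::finite \<Rightarrow> int"
  assumes evo: "pinned_evolution A u" and "0 < L"
    and good: "\<And>t x. \<tau> \<le> t \<Longrightarrow> (x, u t x) \<notin> B \<Longrightarrow> (x, u t x) \<in> Z \<Longrightarrow> descends u t \<tau> L x"
    and worst: "\<And>t x. T \<le> t \<Longrightarrow> (x, u t x) \<in> Z \<Longrightarrow> descends u t T k x"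
    and "0 < k"
    and Z: "\<And>x' w. w \<le> y \<Longrightarrow> y - int H < w \<Longrightarrow> x' \<in> nbhd ((int CARD('n) + 2) * (y - w)) x \<Longrightarrow> (x', w) \<in> Z"
    and fin: "finite (snd ` (Z \<inter> B))"
    and "u t x' \<le> y" "x' \<in> nbhd ((int CARD('n) + 2) * (y - u t x')) x"
    and "u t x' \<le> y - int H + int (q * L)"
    and "q * \<tau> + card {h \<in> snd ` (Z \<inter> B). h \<le> u t x'} * T \<le> t"
  shows "\<exists>x''. u (t - (q * \<tau> + card {h \<in> snd ` (Z \<inter> B). h \<le> u t x'} * T)) x'' \<le> y - int H \<and>
      x'' \<in> nbhd ((int CARD('n) + 2) *
        (y - u (t - (q * \<tau> + card {h \<in> snd ` (Z \<inter> B). h \<le> u t x'} * T)) x'')) x"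
  using assms(8-)
proof (induction "nat (u t x' - (y - int H))" arbitrary: t x' q rule: less_induct)
  case less
  let ?M = "int CARD('n) + 2"
  let ?N = "\<lambda>w. card {h \<in> snd ` (Z \<inter> B). h \<le> w}"
  let ?w = "u t x'"
  define P where "P s = (\<exists>x''. u s x'' \<le> y - int H \<and> x'' \<in> nbhd (?M * (y - u s x'')) x)" for s
  have N_mono: "?N w \<le> ?N w'" if "w \<le> w'" for w w'
    by (rule card_mono) (use fin that in auto)
  have earlier: "P s'" if Ps: "P s" and le_s: "s' \<le> s" for s s'
  proof -
    obtain x'' where x'': "u s x'' \<le> y - int H" "x'' \<in> nbhd (?M * (y - u s x'')) x"
      using Ps unfolding P_def by blast
    have le: "u s' x'' \<le> u s x''"
      by (rule pinned_evolution_mono[OF evo le_s])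
    then have "nbhd (?M * (y - u s x'')) x \<subseteq> nbhd (?M * (y - u s' x'')) x"
      by (intro nbhd_mono mult_left_mono) auto
    with x'' le show ?thesis
      unfolding P_def by (meson order_trans subsetD)
  qed
  have step: "P (t - (q * \<tau> + ?N ?w * T))"
    if desc: "descends u t \<sigma> l x'" and "0 < l" and time: "\<sigma> + (q' * \<tau> + ?N (?w - int l) * T) \<le> q * \<tau> + ?N ?w * T"
      and fuel: "?w - int l \<le> y - int H + int (q' * L)" and above: "y - int H < ?w" for \<sigma> l q'
  proof -
    obtain x1 where x1: "u (t - \<sigma>) x1 \<le> ?w - int l" "x1 \<in> nbhd (?M * (?w - u (t - \<sigma>) x1)) x'"
      using desc unfolding descends_def by blast
    let ?w1 = "u (t - \<sigma>) x1"
    have "x1 \<in> nbhd (?M * (y - ?w) + ?M * (?w - ?w1)) x"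
      by (rule nbhd_trans[OF less.prems(2) x1(2)])
    then have near: "x1 \<in> nbhd (?M * (y - ?w1)) x"
      by (simp add: algebra_simps)
    have smaller: "nat (?w1 - (y - int H)) < nat (?w - (y - int H))"
      using x1(1) \<open>0 < l\<close> above by linarith
    have N1: "?N ?w1 * T \<le> ?N (?w - int l) * T"
      by (intro mult_right_mono N_mono x1(1)) auto
    have "P (t - \<sigma> - (q' * \<tau> + ?N ?w1 * T))"
      unfolding P_def
    proof (rule less.hyps[OF smaller])
      show "?w1 \<le> y" using x1(1) less.prems(1) by linarith
      show "x1 \<in> nbhd (?M * (y - ?w1)) x" by (rule near)
      show "?w1 \<le> y - int H + int (q' * L)" using x1(1) fuel by linarith
      show "q' * \<tau> + ?N ?w1 * T \<le> t - \<sigma>" using N1 time less.prems(4) by linarith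
    qed
    then show ?thesis
      by (rule earlier) (use N1 time in linarith)
  qed
  have "P (t - (q * \<tau> + ?N ?w * T))"
  proof (cases "?w \<le> y - int H")
    case True
    then have "P t"
      unfolding P_def using less.prems(2) by blast
    then show ?thesis
      by (rule earlier) simp
  next
    case False
    then have above: "y - int H < ?w" by simp
    have inZ: "(x', ?w) \<in> Z"
      by (rule Z[OF less.prems(1) above less.prems(2)])
    show ?thesis
    proof (cases "(x', ?w) \<in> B")
      case False
      have "q \<noteq> 0"
        using above less.prems(3) by (cases q) auto
      then obtain q' where q: "q = Suc q'" by (cases q) auto
      have "\<tau> \<le> t"
        using less.prems(4) unfolding q by simp
      then have "descends u t \<tau> L x'"
        by (rule good[OF _ False inZ])
      then show ?thesis
      proof (rule step[OF _ \<open>0 < L\<close> _ _ above])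
        show "\<tau> + (q' * \<tau> + ?N (?w - int L) * T) \<le> q * \<tau> + ?N ?w * T"
          unfolding q using mult_right_mono[OF N_mono[of "?w - int L" ?w], of T] by simp
        show "?w - int L \<le> y - int H + int (q' * L)"
          using less.prems(3) unfolding q by (simp add: algebra_simps)
      qed
    next
      case True
      have less: "?N (?w - int k) < ?N ?w"
      proof (rule psubset_card_mono)
        show "finite {h \<in> snd ` (Z \<inter> B). h \<le> ?w}"
          using fin by simp
        have "?w \<in> {h \<in> snd ` (Z \<inter> B). h \<le> ?w}"
          using True inZ by force
        moreover have "?w \<notin> {h \<in> snd ` (Z \<inter> B). h \<le> ?w - int k}"
          using \<open>0 < k\<close> by simp
        ultimately show "{h \<in> snd ` (Z \<inter> B). h \<le> ?w - int k} \<subset> {h \<in> snd ` (Z \<inter> B). h \<le> ?w}"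
          by force
      qed
      have "Suc (?N (?w - int k)) * T \<le> ?N ?w * T"
        by (rule mult_right_mono) (use less in auto)
      then have time: "T + (q * \<tau> + ?N (?w - int k) * T) \<le> q * \<tau> + ?N ?w * T"
        by simp
      then have "T \<le> t"
        using less.prems(4) by linarith
      then have "descends u t T k x'"
        by (rule worst[OF _ inZ])
      then show ?thesis
        by (rule step[OF _ \<open>0 < k\<close> time _ above]) (use less.prems(3) in auto)
    qed
  qed
  then show ?case
    unfolding P_def .
qed

lemma descends_if_not_bad:
  fixes u :: "nat \<Rightarrow> int ^ 'n::finite \<Rightarrow> int"
  assumes evo: "pinned_evolution A u" and K: "4 * CARD('n) \<le> K" "2 \<le> K"
  shows "descent_time CARD('n) K j \<le> t \<Longrightarrow> \<not> hit (bad K j (x, u t x)) A \<Longrightarrow>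
    descends u t (descent_time CARD('n) K j) (level_size K j) x"
proof (induction j arbitrary: t x)
  case 0
  then show ?case
    using descends_if_no_stall[OF evo K(1), of t x] by (simp add: level_size_0)
next
  case (Suc j)
  let ?n = "CARD('n)"
  let ?M = "int ?n + 2"
  let ?L = "level_size K j" and ?\<tau> = "descent_time ?n K j" and ?T = "stall_time ?n (K * 2 ^ j)"
  let ?H = "level_size K (Suc j)"
  define y where "y = u t x"
  define Z where "Z = zball (int ((?n + 2) * ?H)) (x, y)"
  define B where "B = {z. hit (bad K j z) A}"
  let ?N = "card {h \<in> snd ` (Z \<inter> B). h \<le> u t x}"
  have ok: "\<not> hit (bad K (Suc j) (x, y)) A"
    using Suc.prems(2) unfolding y_def .
  have no_stall: "\<not> hit (stall (K * 2 ^ j) z') A" if "z' \<in> Z" for z'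
    using ok bad_Suc_stall[of z' K j "(x, y)"] that unfolding Z_def hit_def by blast
  have fin: "finite (snd ` (Z \<inter> B))"
    unfolding Z_def by (simp add: finite_zball)
  have inZ: "(x', w) \<in> Z" if "w \<le> y" "y - int ?H < w" "x' \<in> nbhd (?M * (y - w)) x" for x' w
  proof -
    have "?M * (y - w) \<le> ?M * int ?H"
      using that by (intro mult_left_mono) auto
    also have "\<dots> = int ((?n + 2) * ?H)"
      by (simp add: algebra_simps)
    finally have "x' \<in> nbhd (int ((?n + 2) * ?H)) x"
      using that(3) nbhd_mono by blast
    moreover define X where "X = int ((?n + 2) * ?H)"
    moreover have "int ?H \<le> X"
      unfolding X_def of_nat_le_iff by simp
    ultimately show ?thesis
      using that(1,2) unfolding Z_def zball_def X_def[symmetric] by simp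
  qed
  have L: "0 < ?L" "0 < K * 2 ^ j"
    using K level_size_ge[of K j] by auto
  have ZB: "Z \<inter> B = {z' \<in> zball (int ((?n + 2) * ?H)) (x, y). hit (bad K j z') A}"
    unfolding Z_def B_def by auto
  have few: "?N \<le> 2 * (2 * (6 * (?n + 2) * ?L) + 1)"
  proof -
    have "?N \<le> card (snd ` (Z \<inter> B))"
      by (rule card_mono[OF fin]) auto
    also have "\<dots> \<le> 2 * (2 * (6 * (?n + 2) * ?L) + 1)"
      unfolding ZB by (rule bad_heights_card[OF ok])
    finally show ?thesis .
  qed
  let ?s = "?L * ?\<tau> + ?N * ?T"
  have s: "?s \<le> descent_time ?n K (Suc j)"
    using mult_right_mono[OF few, of ?T] by simp
  have "\<exists>x''. u (t - ?s) x'' \<le> y - int ?H \<and> x'' \<in> nbhd (?M * (y - u (t - ?s) x'')) x"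
  proof (rule chain_at_next_level[OF evo L(1) _ _ L(2) _ fin])
    show "descends u t' ?\<tau> ?L x'" if "?\<tau> \<le> t'" "(x', u t' x') \<notin> B" for t' x'
      using Suc.IH[OF that(1)] that(2) unfolding B_def by simp
    show "descends u t' ?T (K * 2 ^ j) x'" if "?T \<le> t'" "(x', u t' x') \<in> Z" for t' x'
      by (rule descends_if_no_stall[OF evo _ that(1) no_stall[OF that(2)]])
        (use K in \<open>auto intro: order_trans[OF K(1)]\<close>)
    show "(x', w) \<in> Z" if "w \<le> y" "y - int ?H < w" "x' \<in> nbhd (?M * (y - w)) x" for x' w
      using inZ that by blast
    show "u t x \<le> y - int ?H + int (?L * ?L)"
      by (simp add: level_size_Suc y_def)
    show "?s \<le> t"
      using s Suc.prems(1) by linarith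
  qed (auto simp: nbhd_self y_def)
  then have "descends u t ?s ?H x"
    unfolding descends_def y_def[symmetric] .
  then show ?case
    by (rule descends_mono[OF evo _ s])
qed

section \<open>Bad sites are rare\<close>

lemma weight_stall:
  fixes z :: "(int ^ 'n::finite) \<times> int"
  assumes b: "0 \<le> b" "20 * b \<le> 1"
  shows "weight (b ^ (4 * CARD('n) + 2)) (stall k z) \<le> (20 * b) ^ k"
proof -
  let ?p = "b ^ (4 * CARD('n) + 2)"
  have pow: "k \<le> k ^ CARD('n)"
    by (cases "k = 0") (simp_all add: self_le_power)
  have "weight ?p (stall k z) \<le> (\<Sum>y\<in>{snd z - int k <.. snd z}. weight ?p (dense_graphs k (fst z) y))"
    unfolding stall_def by (rule weight_UN) (use b finite_dense_graphs in auto)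
  also have "\<dots> \<le> (\<Sum>y\<in>{snd z - int k <.. snd z}. (10 * b) ^ k)"
  proof (rule sum_mono)
    fix y
    have "weight ?p (dense_graphs k (fst z) y) \<le> (10 * b) ^ (k ^ CARD('n))"
      by (rule weight_dense_graphs) (use b in auto)
    also have "\<dots> \<le> (10 * b) ^ k"
      by (rule power_decreasing[OF pow]) (use b in auto)
    finally show "weight ?p (dense_graphs k (fst z) y) \<le> (10 * b) ^ k" .
  qed
  also have "\<dots> = real k * (10 * b) ^ k"
    by simp
  also have "\<dots> \<le> 2 ^ k * (10 * b) ^ k"
    by (rule mult_right_mono) (use b of_nat_less_two_power[of k, where 'a=real] in \<open>auto intro: less_imp_le\<close>)
  also have "\<dots> = (2 * (10 * b)) ^ k"
    by (rule power_mult_distrib[symmetric])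
  finally show ?thesis by simp
qed

text \<open>
  Exponents add over disjoint witnesses, so the sum over triples of witnesses factorizes.
\<close>

lemma weight_triples:
  fixes I :: "('i \<times> 'i \<times> 'i) set" and F :: "'i \<Rightarrow> 'a set set"
  assumes p: "0 \<le> p" and "finite I"
    and fin: "\<And>i. finite (F i)" "\<And>i W. W \<in> F i \<Longrightarrow> finite W"
    and disj: "\<And>i1 i2 i3 W1 W2 W3. (i1, i2, i3) \<in> I \<Longrightarrow> W1 \<in> F i1 \<Longrightarrow> W2 \<in> F i2 \<Longrightarrow> W3 \<in> F i3 \<Longrightarrow>
      W1 \<inter> W2 = {} \<and> W1 \<inter> W3 = {} \<and> W2 \<inter> W3 = {}"
    and q: "\<And>i. weight p (F i) \<le> q"
  shows "weight p (\<Union>(i1, i2, i3)\<in>I. (\<lambda>(W1, W2, W3). W1 \<union> W2 \<union> W3) ` (F i1 \<times> F i2 \<times> F i3))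
    \<le> real (card I) * q ^ 3"
proof -
  let ?U = "\<lambda>(W1, W2, W3). W1 \<union> W2 \<union> W3"
  let ?G = "\<lambda>i. case i of (i1, i2, i3) \<Rightarrow> ?U ` (F i1 \<times> F i2 \<times> F i3)"
  have "weight p (\<Union>i\<in>I. ?G i) \<le> (\<Sum>i\<in>I. weight p (?G i))"
    by (rule weight_UN) (use assms in \<open>auto split: prod.split\<close>)
  also have "\<dots> \<le> (\<Sum>i\<in>I. q ^ 3)"
  proof (rule sum_mono)
    fix i assume "i \<in> I"
    obtain i1 i2 i3 where i: "i = (i1, i2, i3)" by (metis prod_cases3)
    have fin_prod: "finite (F i1 \<times> F i2 \<times> F i3)"
      using fin by auto
    have nonneg: "0 \<le> weight p (F i')" for i'
      unfolding weight_def using p by (intro sum_nonneg) simp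
    have "weight p (?G i) \<le> (\<Sum>W\<in>F i1 \<times> F i2 \<times> F i3. p ^ card (?U W))"
      unfolding weight_def i
      using sum_image_le[OF fin_prod, of "\<lambda>W. p ^ card W" ?U] p by (simp add: o_def)
    also have "\<dots> = (\<Sum>(W1, W2, W3)\<in>F i1 \<times> F i2 \<times> F i3. p ^ card W1 * (p ^ card W2 * p ^ card W3))"
    proof (rule sum.cong[OF refl])
      fix W assume "W \<in> F i1 \<times> F i2 \<times> F i3"
      then obtain W1 W2 W3 where W: "W = (W1, W2, W3)" "W1 \<in> F i1" "W2 \<in> F i2" "W3 \<in> F i3"
        by auto
      have "card (W1 \<union> W2 \<union> W3) = card W1 + card W2 + card W3"
        using disj[OF \<open>i \<in> I\<close>[unfolded i] W(2-4)] fin(2)[OF W(2)] fin(2)[OF W(3)] fin(2)[OF W(4)]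
        by (subst card_Un_disjoint; auto simp: card_Un_disjoint)
      then show "p ^ card (?U W) = (case W of (W1, W2, W3) \<Rightarrow> p ^ card W1 * (p ^ card W2 * p ^ card W3))"
        by (simp add: W(1) power_add)
    qed
    also have "\<dots> = weight p (F i1) * (weight p (F i2) * weight p (F i3))"
      unfolding weight_def
      by (simp only: sum.cartesian_product[symmetric] sum_distrib_left[symmetric] sum_distrib_right[symmetric])
    also have "\<dots> \<le> q * (q * q)"
      by (intro mult_mono q mult_nonneg_nonneg nonneg order_trans[OF nonneg q])
    finally show "weight p (?G i) \<le> q ^ 3"
      by (simp add: power3_eq_cube mult.assoc)
  qed
  also have "\<dots> = real (card I) * q ^ 3"
    by simp
  finally show ?thesis by (simp add: case_prod_beta)
qed

lemma card_zball_le: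
  fixes z :: "(int ^ 'n::finite) \<times> int"
  assumes "1 \<le> L"
  shows "card (zball (int ((CARD('n) + 2) * L)) z) \<le> (3 * (CARD('n) + 2)) ^ (CARD('n) + 1) * L ^ (CARD('n) + 1)"
proof -
  have "2 * ((CARD('n) + 2) * L) + 1 \<le> 3 * (CARD('n) + 2) * L"
    using assms by (simp add: algebra_simps)
  then have "(2 * ((CARD('n) + 2) * L) + 1) ^ (CARD('n) + 1) \<le> (3 * (CARD('n) + 2) * L) ^ (CARD('n) + 1)"
    by (rule power_mono) simp
  then show ?thesis
    by (simp only: card_zball power_mult_distrib)
qed

text \<open>
  With \<open>\<gamma> = 6 d + 1\<close>, there are at most \<open>Q\<^sup>3 L\<^sub>j ^ (6 d)\<close> triples, each of weight at most
  \<open>L\<^sub>j ^ (- 3 \<gamma>)\<close>.  Relative to the target \<open>L\<^sub>j ^ (- 2 \<gamma>)\<close> this leaves \<open>Q\<^sup>3 / L\<^sub>j\<close>, which is at most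
  \<open>1/2\<close> by the choice of \<open>K\<close>.  The dense graphs of side \<open>K 2\<^sup>j\<close> have weight at most
  \<open>((20 b) ^ K) ^ 2\<^sup>j\<close>, again a negative power of \<open>L\<^sub>j = K ^ 2\<^sup>j\<close>.
\<close>

lemma weight_bad:
  fixes z :: "(int ^ 'n::finite) \<times> int"
  defines "d \<equiv> CARD('n) + 1"
  defines "Q \<equiv> (3 * (CARD('n) + 2)) ^ d"
  defines "\<gamma> \<equiv> 6 * d + 1"
  assumes b: "0 \<le> b" "20 * b \<le> 1" and K: "2 * Q ^ 3 \<le> K"
    and small: "(20 * b) ^ K * real K ^ (2 * d + 2 * \<gamma> + 1) \<le> 1"
  shows "weight (b ^ (4 * CARD('n) + 2)) (bad K j z) \<le> 1 / real (level_size K j) ^ \<gamma>"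
proof (induction j arbitrary: z)
  case 0
  have Q1: "1 \<le> Q"
    unfolding Q_def by simp
  have K1: "1 \<le> K"
    using K Q1 one_le_power[OF Q1, of 3] by linarith
  have "weight (b ^ (4 * CARD('n) + 2)) (bad K 0 z) \<le> (20 * b) ^ K"
    using weight_stall[OF b, of K z] by simp
  also have "\<dots> \<le> 1 / real K ^ (2 * d + 2 * \<gamma> + 1)"
    using small K1 by (simp add: field_simps)
  also have "\<dots> \<le> 1 / real K ^ \<gamma>"
    using K1 by (intro divide_left_mono power_increasing) auto
  finally show ?case
    by (simp add: level_size_0)
next
  case (Suc j)
  let ?p = "b ^ (4 * CARD('n) + 2)"
  let ?M = "CARD('n) + 2"
  let ?L = "level_size K j"
  let ?Z = "zball (int (?M * level_size K (Suc j))) z"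
  let ?I = "bad_triples (?M * level_size K (Suc j)) (6 * ?M * ?L) z"
  let ?F = "\<Union>z'\<in>?Z. stall (K * 2 ^ j) z'"
  let ?G = "\<Union>(z1, z2, z3)\<in>?I. (\<lambda>(W1, W2, W3). W1 \<union> W2 \<union> W3) ` (bad K j z1 \<times> bad K j z2 \<times> bad K j z3)"
  have Q1: "1 \<le> Q"
    unfolding Q_def by simp
  have K2: "2 \<le> K"
    using K one_le_power[OF Q1, of 3] by linarith
  have L: "K \<le> ?L"
    using level_size_ge[of K j] K2 by simp
  have L1: "1 \<le> real ?L"
    using L K2 by linarith
  have p: "0 \<le> ?p"
    using b by simp
  have cardZ: "real (card ?Z) \<le> real Q * real ?L ^ (2 * d)"
  proof -
    have "card ?Z \<le> Q * level_size K (Suc j) ^ d"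
      unfolding Q_def d_def by (rule card_zball_le) (use L K2 in \<open>simp add: level_size_Suc\<close>)
    also have "\<dots> = Q * ?L ^ (2 * d)"
      by (simp add: level_size_Suc power_mult power2_eq_square)
    finally show ?thesis
      by (simp flip: of_nat_mult of_nat_power)
  qed
  have "weight ?p ?F \<le> (\<Sum>z'\<in>?Z. weight ?p (stall (K * 2 ^ j) z'))"
    by (rule weight_UN) (use p finite_stall in \<open>auto simp: finite_zball\<close>)
  also have "\<dots> \<le> (\<Sum>z'\<in>?Z. (20 * b) ^ (K * 2 ^ j))"
    by (intro sum_mono weight_stall b)
  also have "\<dots> = real (card ?Z) * (20 * b) ^ (K * 2 ^ j)"
    by simp
  also have "\<dots> \<le> real Q * real ?L ^ (2 * d) * (1 / real ?L ^ (2 * d + 2 * \<gamma> + 1))"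
  proof (rule mult_mono[OF cardZ])
    have "(20 * b) ^ (K * 2 ^ j) = ((20 * b) ^ K) ^ 2 ^ j"
      by (rule power_mult)
    also have "\<dots> \<le> (1 / real K ^ (2 * d + 2 * \<gamma> + 1)) ^ 2 ^ j"
      by (rule power_mono) (use small K2 b in \<open>auto simp: field_simps\<close>)
    also have "\<dots> = 1 / real ?L ^ (2 * d + 2 * \<gamma> + 1)"
      by (simp only: level_size_def power_one_over of_nat_power power_mult[symmetric] mult.commute)
    finally show "(20 * b) ^ (K * 2 ^ j) \<le> 1 / real ?L ^ (2 * d + 2 * \<gamma> + 1)" .
  qed (use b in auto)
  also have "\<dots> = real Q / real ?L * (1 / real ?L ^ (2 * \<gamma>))"
    using L1 by (simp add: power_add field_simps)
  finally have F: "weight ?p ?F \<le> real Q / real ?L * (1 / real ?L ^ (2 * \<gamma>))" .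
  have "weight ?p ?G \<le> real (card ?I) * (1 / real ?L ^ \<gamma>) ^ 3"
  proof (rule weight_triples[where F = "bad K j", OF p finite_bad_triples])
    fix z1 z2 z3 W1 W2 W3
    assume tri: "(z1, z2, z3) \<in> ?I" and W: "W1 \<in> bad K j z1" "W2 \<in> bad K j z2" "W3 \<in> bad K j z3"
    have dbl: "int (6 * ?M * ?L) = 2 * int (3 * ?M * ?L)"
      by simp
    have "z2 \<notin> zball (2 * int (3 * ?M * ?L)) z1" "z3 \<notin> zball (2 * int (3 * ?M * ?L)) z1"
      "z3 \<notin> zball (2 * int (3 * ?M * ?L)) z2"
      using tri unfolding bad_triples_def dbl by auto
    from this[THEN far_balls_disjoint]
    show "W1 \<inter> W2 = {} \<and> W1 \<inter> W3 = {} \<and> W2 \<inter> W3 = {}"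
      using bad_support[OF K2 W(1)] bad_support[OF K2 W(2)] bad_support[OF K2 W(3)] by blast
  next
    fix z' :: "(int ^ 'n) \<times> int"
    show "weight ?p (bad K j z') \<le> 1 / real ?L ^ \<gamma>"
      by (rule Suc.IH)
  qed (auto simp: finite_bad)
  also have "\<dots> \<le> (real Q * real ?L ^ (2 * d)) ^ 3 * (1 / real ?L ^ \<gamma>) ^ 3"
  proof (rule mult_right_mono)
    have "card ?I \<le> card (?Z \<times> ?Z \<times> ?Z)"
      by (rule card_mono) (auto simp: bad_triples_def finite_zball)
    also have "\<dots> = card ?Z ^ 3"
      by (simp add: card_cartesian_product power3_eq_cube)
    finally have "real (card ?I) \<le> real (card ?Z) ^ 3"
      by (simp only: of_nat_le_iff flip: of_nat_power)
    also have "\<dots> \<le> (real Q * real ?L ^ (2 * d)) ^ 3"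
      by (rule power_mono[OF cardZ]) simp
    finally show "real (card ?I) \<le> (real Q * real ?L ^ (2 * d)) ^ 3" .
  qed simp
  also have "\<dots> = real Q ^ 3 / real ?L * (1 / real ?L ^ (2 * \<gamma>))"
  proof -
    have "real ?L ^ (3 * \<gamma>) = (real ?L ^ (2 * d)) ^ 3 * (real ?L * real ?L ^ (2 * \<gamma>))"
    proof -
      have "3 * \<gamma> = 2 * d * 3 + (1 + 2 * \<gamma>)"
        unfolding \<gamma>_def by simp
      then show ?thesis
        by (simp only: power_add power_mult power_one_right)
    qed
    then show ?thesis
      using L1 by (simp add: power_mult_distrib power_one_over power_mult[symmetric] mult.commute field_simps)
  qed
  finally have G: "weight ?p ?G \<le> real Q ^ 3 / real ?L * (1 / real ?L ^ (2 * \<gamma>))" .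
  have "weight ?p (bad K (Suc j) z) \<le> weight ?p ?F + weight ?p ?G"
    unfolding bad.simps
    by (rule weight_Un[OF p]) (auto simp: finite_stall finite_zball finite_bad_triples finite_bad)
  also have "\<dots> \<le> real Q / real ?L * (1 / real ?L ^ (2 * \<gamma>)) + real Q ^ 3 / real ?L * (1 / real ?L ^ (2 * \<gamma>))"
    by (rule add_mono[OF F G])
  also have "\<dots> = (real Q / real ?L + real Q ^ 3 / real ?L) * (1 / real ?L ^ (2 * \<gamma>))"
    by (rule distrib_right[symmetric])
  also have "\<dots> \<le> 1 * (1 / real ?L ^ (2 * \<gamma>))"
  proof (rule mult_right_mono)
    have "Q \<le> Q ^ 3"
      by (rule self_le_power) (use Q1 in auto)
    then have "Q + Q ^ 3 \<le> ?L"
      using K L by linarith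
    then have "real (Q + Q ^ 3) \<le> real ?L"
      by (simp only: of_nat_le_iff)
    then show "real Q / real ?L + real Q ^ 3 / real ?L \<le> 1"
      using L1 by (simp add: add_divide_distrib[symmetric])
  qed simp
  also have "\<dots> = 1 / real (level_size K (Suc j)) ^ \<gamma>"
    by (simp add: level_size_Suc power_mult power2_eq_square)
  finally show ?case .
qed

section \<open>Positive speed\<close>

lemma stall_time_le:
  assumes "1 \<le> k"
  shows "stall_time n k \<le> (2 * (n + 2) + 1) ^ n * (2 * n * (n + 2) + 1) * k ^ (n + 1)"
proof -
  have "2 * ((n + 2) * k) + 1 \<le> (2 * (n + 2) + 1) * k"
    using assms by (simp add: algebra_simps)
  then have "(2 * ((n + 2) * k) + 1) ^ n \<le> ((2 * (n + 2) + 1) * k) ^ n"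
    by (rule power_mono) simp
  then have "stall_time n k \<le> ((2 * (n + 2) + 1) * k) ^ n * (2 * n * ((n + 2) * k) + k)"
    unfolding stall_time_def by (rule mult_right_mono) simp
  also have "\<dots> = (2 * (n + 2) + 1) ^ n * (2 * n * (n + 2) + 1) * k ^ (n + 1)"
    unfolding power_mult_distrib by (simp add: algebra_simps)
  finally show ?thesis .
qed

text \<open>
  The ratio of the duration to \<open>L\<^sub>j\<close> grows from one level to the next by a multiple of
  \<open>(K 2\<^sup>j) ^ (n + 1) / L\<^sub>j\<close>.  This is \<open>O(2\<^sup>-\<^sup>j)\<close> because \<open>L\<^sub>j\<close> is exponential in \<open>2\<^sup>j\<close>, so the increments
  are summable.
\<close>

lemma descent_time_linear:
  assumes K: "2 \<le> K"
  shows "\<exists>v > 0. \<forall>j. descent_time n K j \<le> v * level_size K j"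
proof -
  obtain C where C: "C > 0" "\<And>t. real t ^ (n + 2) \<le> C * real K ^ t"
    using power_le_geometric[of "real K" "n + 2"] K by auto
  define c where "c = (2 * (n + 2) + 1) ^ n * (2 * n * (n + 2) + 1)"
  define c' where "c' = 2 * (12 * (n + 2) + 1)"
  define D where "D = real c' * real c * real K ^ (n + 1) * C"
  have D: "0 \<le> D"
    unfolding D_def using C(1) by simp
  let ?L = "level_size K"
  have L: "1 \<le> ?L j" for j
    using level_size_ge[of K j] K by linarith
  have inc: "real (2 * (2 * (6 * (n + 2) * ?L j) + 1) * stall_time n (K * 2 ^ j))
      \<le> real (?L (Suc j)) * (D / 2 ^ j)" for j
  proof -
    have "2 * (2 * (6 * (n + 2) * ?L j) + 1) \<le> c' * ?L j"
      unfolding c'_def using L[of j] by (simp add: algebra_simps)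
    moreover have "stall_time n (K * 2 ^ j) \<le> c * (K * 2 ^ j) ^ (n + 1)"
      unfolding c_def by (rule stall_time_le) (use K in simp)
    ultimately have "2 * (2 * (6 * (n + 2) * ?L j) + 1) * stall_time n (K * 2 ^ j)
        \<le> (c' * ?L j) * (c * (K * 2 ^ j) ^ (n + 1))"
      by (rule mult_mono) auto
    then have "real (2 * (2 * (6 * (n + 2) * ?L j) + 1) * stall_time n (K * 2 ^ j))
        \<le> real ((c' * ?L j) * (c * (K * 2 ^ j) ^ (n + 1)))"
      by (simp only: of_nat_le_iff)
    also have "\<dots> = real c' * real c * real K ^ (n + 1) * real (?L j) * (2 ^ j) ^ (n + 1)"
      by (simp add: power_mult_distrib)
    also have "\<dots> \<le> real c' * real c * real K ^ (n + 1) * real (?L j) * (C * real (?L j) / 2 ^ j)"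
    proof (rule mult_left_mono)
      have "(2 ^ j) ^ (n + 1) * 2 ^ j = real (2 ^ j) ^ (n + 2)"
        by simp
      also have "\<dots> \<le> C * real (?L j)"
        using C(2)[of "2 ^ j"] unfolding level_size_def of_nat_power .
      finally show "(2 ^ j) ^ (n + 1) \<le> C * real (?L j) / 2 ^ j"
        by (simp only: pos_le_divide_eq zero_less_power zero_less_numeral)
    qed simp
    also have "\<dots> = real (?L (Suc j)) * (D / 2 ^ j)"
      unfolding D_def level_size_Suc by simp
    finally show ?thesis .
  qed
  define v0 where "v0 = real (stall_time n K)"
  have bound: "real (descent_time n K j) \<le> real (?L j) * (v0 + D * (2 - 2 / 2 ^ j))" for j
  proof (induction j)
    case 0
    have "1 * v0 \<le> real K * v0"
      unfolding v0_def using K by (intro mult_right_mono) auto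
    then show ?case
      by (simp add: v0_def level_size_0)
  next
    case (Suc j)
    have "real (descent_time n K (Suc j))
        = real (?L j) * real (descent_time n K j)
          + real (2 * (2 * (6 * (n + 2) * ?L j) + 1) * stall_time n (K * 2 ^ j))"
      by simp
    also have "\<dots> \<le> real (?L j) * (real (?L j) * (v0 + D * (2 - 2 / 2 ^ j))) + real (?L (Suc j)) * (D / 2 ^ j)"
      by (intro add_mono mult_left_mono Suc inc) simp
    also have "\<dots> = real (?L (Suc j)) * (v0 + D * (2 - 2 / 2 ^ Suc j))"
      by (simp add: level_size_Suc field_simps)
    finally show ?case .
  qed
  define v where "v = nat \<lceil>v0 + 2 * D\<rceil> + 1"
  have v: "v0 + 2 * D \<le> real v"
    unfolding v_def by linarith
  have "descent_time n K j \<le> v * ?L j" for j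
  proof -
    have "v0 + D * (2 - 2 / 2 ^ j) \<le> v0 + D * 2"
      using D by (intro add_left_mono mult_left_mono) auto
    then have "v0 + D * (2 - 2 / 2 ^ j) \<le> real v"
      using v by linarith
    then have "real (?L j) * (v0 + D * (2 - 2 / 2 ^ j)) \<le> real (?L j) * real v"
      by (intro mult_left_mono) auto
    then have "real (descent_time n K j) \<le> real (v * ?L j)"
      using bound[of j] by (simp add: mult.commute)
    then show ?thesis
      by (simp only: of_nat_le_iff)
  qed
  moreover have "0 < v"
    unfolding v_def by simp
  ultimately show ?thesis by blast
qed

primrec flat_evolution :: "((int ^ 'n) \<times> int \<Rightarrow> ereal) \<Rightarrow> nat \<Rightarrow> int ^ 'n::finite \<Rightarrow> int" where
  "flat_evolution env 0 = (\<lambda>_. 0)"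
| "flat_evolution env (Suc t) =
     (\<lambda>x. flat_evolution env t x +
       jump_finite (\<lambda>e. flat_evolution env t (x + e) - flat_evolution env t x) (env (x, flat_evolution env t x)))"

lemma surface_at_flat: "surface_at env (\<lambda>_. Fin 0) t = (\<lambda>x. Fin (flat_evolution env t x))"
proof (induction t)
  case 0
  then show ?case by (simp add: surface_at_def)
next
  case (Suc t)
  have "surface_at env (\<lambda>_. Fin 0) (Suc t) = evolve env (surface_at env (\<lambda>_. Fin 0) t)"
    by (simp add: surface_at_def)
  also have "\<dots> = evolve env (\<lambda>x. Fin (flat_evolution env t x))"
    by (simp only: Suc)
  also have "\<dots> = (\<lambda>x. Fin (flat_evolution env (Suc t) x))"
  proof
    fix x
    show "evolve env (\<lambda>x. Fin (flat_evolution env t x)) x = Fin (flat_evolution env (Suc t) x)"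
      by (subst evolve_Fin[where f = "flat_evolution env t"]) auto
  qed
  finally show ?case .
qed

lemma jump_finite_cases: "jump_finite a w = 0 \<or> jump_finite a w = 1 \<and> (\<forall>e\<in>directions. a e > -2)"
  unfolding jump_finite_def by (auto simp: of_bool_def max_def)

lemma flat_evolution_pinned:
  fixes \<omega> :: "(int ^ 'n::finite) \<times> int \<Rightarrow> 'w \<Rightarrow> real"
  shows "pinned_evolution (pins \<omega> s) (flat_evolution (\<lambda>z. ereal (\<omega> z s)))"
proof -
  let ?u = "flat_evolution (\<lambda>z. ereal (\<omega> z s))"
  define J where "J t x = jump_finite (\<lambda>e. ?u t (x + e) - ?u t x) (ereal (\<omega> (x, ?u t x) s))" for t x
  have Suc_u: "?u (Suc t) x = ?u t x + J t x" for t x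
    unfolding J_def by simp
  have J: "J t x = 0 \<or> J t x = 1 \<and> (\<forall>e\<in>directions. ?u t (x + e) - ?u t x > -2)" for t x
    unfolding J_def by (rule jump_finite_cases)
  have "\<bar>?u t (x + e) - ?u t x\<bar> \<le> 2" if e: "e \<in> directions" for t x e
  proof (induction t)
    case 0
    then show ?case by simp
  next
    case (Suc t)
    have "?u t (x + e + - e) = ?u t x"
      by simp
    moreover have "- e \<in> directions"
      by (rule directions_uminus[OF e])
    ultimately have "J t (x + e) = 1 \<Longrightarrow> ?u t x - ?u t (x + e) > -2"
      using J[of t "x + e"] by (metis zero_neq_one)
    moreover have "J t x = 1 \<Longrightarrow> ?u t (x + e) - ?u t x > -2"
      using J[of t x] e by auto
    ultimately show ?case
      using Suc J[of t x] J[of t "x + e"] unfolding Suc_u by linarith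
  qed
  then have "lipschitz_within UNIV (?u t)" for t
    unfolding lipschitz_within_def by simp
  moreover have "?u (Suc t) x = ?u t x + 1 \<or> ?u (Suc t) x = ?u t x \<and> stuck (pins \<omega> s) (?u t) x" for t x
  proof (cases "J t x = 1")
    case True
    then have "?u (Suc t) x = ?u t x + 1" using Suc_u[of t x] by (simp only:)
    then show ?thesis by (rule disjI1)
  next
    case False
    then have "J t x = 0" using J by blast
    moreover from this have "stuck (pins \<omega> s) (?u t) x"
      unfolding J_def by (rule no_jump_imp_stuck) (simp add: pins_def)
    moreover have "?u (Suc t) x = ?u t x" using Suc_u[of t x] \<open>J t x = 0\<close> by (simp only: add_0_right)
    ultimately show ?thesis by blast
  qed
  ultimately show ?thesis
    unfolding pinned_evolution_def by blast
qed

lemma evolution_upper_bound: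
  assumes "pinned_evolution A u" "u 0 x = 0"
  shows "u t x \<le> int t"
proof (induction t)
  case 0
  then show ?case using assms by simp
next
  case (Suc t)
  then show ?case
    using assms(1) unfolding pinned_evolution_def by (smt (verit) of_nat_Suc)
qed

text \<open>
  The surface rises by at most one per step, so every point of the chain lies within distance
  \<open>(n + 2) t\<close> of the origin, where no site is bad.  Each descent lowers the height by \<open>L\<^sub>j\<close> in time
  \<open>v L\<^sub>j\<close>, and there is time for at least \<open>t / (2 v L\<^sub>j)\<close> of them.
\<close>

lemma speed_if_no_bad_sites:
  fixes u :: "nat \<Rightarrow> int ^ 'n::finite \<Rightarrow> int"
  assumes evo: "pinned_evolution A u" and zero: "\<And>x. u 0 x = 0"
    and K: "4 * CARD('n) \<le> K" "2 \<le> K"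
    and v: "0 < v" "descent_time CARD('n) K j \<le> v * level_size K j"
    and clean: "\<And>z. z \<in> zball (int ((CARD('n) + 2) * t)) (0, 0) \<Longrightarrow> \<not> hit (bad K j z) A"
    and t: "v * level_size K j \<le> t"
  shows "real t \<le> 2 * real v * real_of_int (u t 0)"
proof -
  let ?M = "int CARD('n) + 2"
  let ?L = "level_size K j"
  have L: "0 < ?L"
    using level_size_ge[of K j] K by linarith
  have nonneg: "0 \<le> u s x" for s x
    using pinned_evolution_mono[OF evo, of 0 s x] zero by simp
  have upper: "u t 0 \<le> int t"
    by (rule evolution_upper_bound[OF evo zero])
  have chain: "q * (v * ?L) \<le> t \<Longrightarrow>
      \<exists>x. u (t - q * (v * ?L)) x \<le> u t 0 - int (q * ?L) \<and>
          x \<in> nbhd (?M * (u t 0 - u (t - q * (v * ?L)) x)) 0" for q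
  proof (induction q)
    case 0
    then show ?case by (intro exI[of _ 0]) (simp add: nbhd_self)
  next
    case (Suc q)
    let ?s = "t - q * (v * ?L)"
    obtain x where x: "u ?s x \<le> u t 0 - int (q * ?L)" "x \<in> nbhd (?M * (u t 0 - u ?s x)) 0"
      using Suc by auto
    have time: "v * ?L \<le> ?s" "?s - v * ?L = t - Suc q * (v * ?L)"
      using Suc.prems by auto
    have "u t 0 - u ?s x \<le> int t"
      using upper nonneg[of ?s x] by linarith
    then have "?M * (u t 0 - u ?s x) \<le> ?M * int t"
      by (intro mult_left_mono) auto
    also have "\<dots> = int ((CARD('n) + 2) * t)"
      by (simp add: algebra_simps)
    finally have "x \<in> nbhd (int ((CARD('n) + 2) * t)) 0"
      using x(2) nbhd_mono by blast
    moreover have "u ?s x \<le> int ((CARD('n) + 2) * t)"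
    proof -
      have "u ?s x \<le> int t"
        using x(1) upper by linarith
      also have "\<dots> \<le> int ((CARD('n) + 2) * t)"
        unfolding of_nat_le_iff by simp
      finally show ?thesis .
    qed
    ultimately have "(x, u ?s x) \<in> zball (int ((CARD('n) + 2) * t)) (0, 0)"
      using nonneg[of ?s x] unfolding zball_def by auto
    then have ok: "\<not> hit (bad K j (x, u ?s x)) A"
      by (rule clean)
    have "descends u ?s (descent_time CARD('n) K j) ?L x"
      by (rule descends_if_not_bad[OF evo K _ ok]) (use v(2) time in linarith)
    then have "descends u ?s (v * ?L) ?L x"
      by (rule descends_mono[OF evo _ v(2)])
    then obtain x' where x': "u (?s - v * ?L) x' \<le> u ?s x - int ?L"
      "x' \<in> nbhd (?M * (u ?s x - u (?s - v * ?L) x')) x"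
      unfolding descends_def by blast
    have "x' \<in> nbhd (?M * (u t 0 - u ?s x) + ?M * (u ?s x - u (?s - v * ?L) x')) 0"
      by (rule nbhd_trans[OF x(2) x'(2)])
    then have "x' \<in> nbhd (?M * (u t 0 - u (?s - v * ?L) x')) 0"
      by (simp add: algebra_simps)
    moreover have "u (?s - v * ?L) x' \<le> u t 0 - int (Suc q * ?L)"
      using x(1) x'(1) by simp
    ultimately show ?case
      unfolding time(2) by blast
  qed
  define \<sigma> where "\<sigma> = v * ?L"
  have \<sigma>: "0 < \<sigma>" "\<sigma> \<le> t"
    unfolding \<sigma>_def using v L t by auto
  define q where "q = t div \<sigma>"
  have q: "q * \<sigma> \<le> t" "t < q * \<sigma> + \<sigma>" "1 \<le> q"
    unfolding q_def using \<sigma> dividend_less_div_times[of \<sigma> t]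
    by (auto simp: div_greater_zero_iff Suc_le_eq algebra_simps)
  obtain x where "u (t - q * \<sigma>) x \<le> u t 0 - int (q * ?L)"
    using chain[of q] q unfolding \<sigma>_def by blast
  then have "int (q * ?L) \<le> u t 0"
    using nonneg[of "t - q * \<sigma>" x] by linarith
  then have high: "real (q * ?L) \<le> real_of_int (u t 0)"
    by (metis of_int_le_iff of_int_of_nat_eq)
  have "1 * \<sigma> \<le> q * \<sigma>"
    by (rule mult_right_mono[OF q(3)]) simp
  then have "t \<le> 2 * (q * \<sigma>)"
    using q(2) by linarith
  also have "\<dots> = 2 * v * (q * ?L)"
    unfolding \<sigma>_def by simp
  finally have "real t \<le> real (2 * v * (q * ?L))"
    by (simp only: of_nat_le_iff)
  also have "\<dots> = 2 * real v * real (q * ?L)"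
    by simp
  also have "\<dots> \<le> 2 * real v * real_of_int (u t 0)"
    by (rule mult_left_mono[OF high]) simp
  finally show ?thesis .
qed

text \<open>
  The box in which level \<open>j\<close> must be free of bad sites has side of order \<open>L\<^sub>j\<^sub>+\<^sub>1 = L\<^sub>j\<^sup>2\<close>, hence of order
  \<open>L\<^sub>j ^ (2 d)\<close> sites, and \<open>L\<^sub>j ^ (2 d) L\<^sub>j ^ (- \<gamma>)\<close> is summable in \<open>j\<close>.
\<close>

lemma positive_speed:
  fixes \<omega> :: "(int ^ 'n::finite) \<times> int \<Rightarrow> 'w \<Rightarrow> real"
  defines "d \<equiv> CARD('n) + 1"
  defines "\<gamma> \<equiv> 6 * d + 1"
  assumes ber: "bernoulli_disorder (b ^ (4 * CARD('n) + 2)) M \<omega>" and b: "0 \<le> b" "20 * b \<le> 1"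
    and K: "4 * CARD('n) \<le> K" "2 * ((3 * (CARD('n) + 2)) ^ d) ^ 3 \<le> K"
    and small: "(20 * b) ^ K * real K ^ (2 * d + 2 * \<gamma> + 1) \<le> 1"
  shows "AE s in M.
    liminf (\<lambda>t. ereal_of_zbar (surface_at (\<lambda>z. ereal (\<omega> z s)) (\<lambda>_. Fin 0) t 0) / ereal (real t)) > 0"
proof -
  interpret prob_space M
    using ber unfolding bernoulli_disorder_def by simp
  let ?p = "b ^ (4 * CARD('n) + 2)"
  let ?M = "CARD('n) + 2"
  let ?L = "level_size K"
  define Q where "Q = (3 * ?M) ^ d"
  have "1 \<le> Q"
    unfolding Q_def by simp
  then have K2: "2 \<le> K"
    using K(2) one_le_power[of Q 3] unfolding Q_def by linarith
  have L1: "1 \<le> ?L j" for j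
    using level_size_ge[of K j] K2 by linarith
  obtain v where v: "0 < v" "\<And>j. descent_time CARD('n) K j \<le> v * ?L j"
    using descent_time_linear[OF K2] by blast
  define F where "F j = (\<Union>z\<in>zball (int (?M * (v * ?L (Suc j)))) (0 :: int ^ 'n, 0). bad K j z)" for j
  have fin: "finite (F j)" "\<And>W. W \<in> F j \<Longrightarrow> finite W" for j
    unfolding F_def by (auto simp: finite_zball finite_bad)
  have prob_F: "prob {s \<in> space M. hit (F j) (pins \<omega> s)} \<le> real (Q * v ^ d) * (1 / 2) ^ j" for j
  proof -
    let ?Z = "zball (int (?M * (v * ?L (Suc j)))) (0 :: int ^ 'n, 0)"
    have "prob {s \<in> space M. hit (F j) (pins \<omega> s)} \<le> weight ?p (F j)"
      by (rule bernoulli_hit(2)[OF ber fin])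
    also have "\<dots> \<le> (\<Sum>z\<in>?Z. weight ?p (bad K j z))"
      unfolding F_def by (rule weight_UN) (use b in \<open>auto simp: finite_zball finite_bad\<close>)
    also have "\<dots> \<le> (\<Sum>z\<in>?Z. 1 / real (?L j) ^ \<gamma>)"
      unfolding \<gamma>_def d_def
      by (intro sum_mono weight_bad b K(2)[unfolded d_def] small[unfolded \<gamma>_def d_def])
    also have "\<dots> = real (card ?Z) * (1 / real (?L j) ^ \<gamma>)"
      by simp
    also have "\<dots> \<le> real (Q * (v * ?L (Suc j)) ^ d) * (1 / real (?L j) ^ \<gamma>)"
    proof (rule mult_right_mono)
      have "card ?Z \<le> Q * (v * ?L (Suc j)) ^ d"
        unfolding Q_def d_def by (rule card_zball_le) (use v(1) L1[of "Suc j"] in \<open>simp add: Suc_le_eq\<close>)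
      then show "real (card ?Z) \<le> real (Q * (v * ?L (Suc j)) ^ d)"
        by (simp only: of_nat_le_iff)
    qed simp
    also have "\<dots> = real (Q * v ^ d) * (real (?L j) ^ (2 * d) / real (?L j) ^ \<gamma>)"
      by (simp add: level_size_Suc power_mult_distrib power_mult power2_eq_square)
    also have "\<dots> \<le> real (Q * v ^ d) * (1 / 2) ^ j"
    proof (rule mult_left_mono)
      have "2 ^ j \<le> K * 2 ^ j"
        using K2 by simp
      also have "\<dots> \<le> ?L j"
        by (rule stall_level_le[OF K2])
      finally have "real (2 ^ j) \<le> real (?L j)"
        by (simp only: of_nat_le_iff)
      moreover have "real (?L j) * real (?L j) ^ (2 * d) \<le> real (?L j) ^ \<gamma>"
        unfolding power_Suc[symmetric] \<gamma>_def using L1[of j] by (intro power_increasing) auto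
      ultimately have "2 ^ j * real (?L j) ^ (2 * d) \<le> real (?L j) ^ \<gamma>"
        using mult_right_mono[of "real (2 ^ j)" "real (?L j)" "real (?L j) ^ (2 * d)"] by simp
      then show "real (?L j) ^ (2 * d) / real (?L j) ^ \<gamma> \<le> (1 / 2) ^ j"
        using L1[of j] by (simp add: power_one_over field_simps)
    qed simp
    finally show ?thesis .
  qed
  have "AE s in M. eventually (\<lambda>j. s \<in> space M - {s \<in> space M. hit (F j) (pins \<omega> s)}) sequentially"
  proof (rule borel_cantelli_AE1)
    show "{s \<in> space M. hit (F j) (pins \<omega> s)} \<in> sets M" for j
      by (rule bernoulli_hit(1)[OF ber fin])
    show "emeasure M {s \<in> space M. hit (F j) (pins \<omega> s)} < \<infinity>" for j
      by (simp add: emeasure_eq_measure)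
    show "summable (\<lambda>j. prob {s \<in> space M. hit (F j) (pins \<omega> s)})"
    proof (rule summable_comparison_test)
      show "\<exists>N. \<forall>j\<ge>N. norm (prob {s \<in> space M. hit (F j) (pins \<omega> s)}) \<le> real (Q * v ^ d) * (1 / 2) ^ j"
        using prob_F by auto
      show "summable (\<lambda>j. real (Q * v ^ d) * (1 / 2 :: real) ^ j)"
        by (intro summable_mult summable_geometric) simp
    qed
  qed
  then show ?thesis
  proof (rule AE_mp, intro AE_I2 impI)
    fix s assume "s \<in> space M"
      and "eventually (\<lambda>j. s \<in> space M - {s \<in> space M. hit (F j) (pins \<omega> s)}) sequentially"
    then obtain j0 where j0: "\<And>j. j0 \<le> j \<Longrightarrow> \<not> hit (F j) (pins \<omega> s)"
      unfolding eventually_sequentially by auto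
    let ?u = "flat_evolution (\<lambda>z. ereal (\<omega> z s))"
    have speed: "real t \<le> 2 * real v * real_of_int (?u t 0)" if t: "v * ?L j0 \<le> t" for t
    proof -
      have "\<not> t < v * ?L (j0 + 0)"
        using t by simp
      moreover have "t < v * ?L (j0 + t)"
      proof -
        have "t < 2 ^ t" by (rule less_exp)
        also have "\<dots> \<le> K * 2 ^ (j0 + t)"
          using K2 by (simp add: power_add mult_le_mono)
        also have "\<dots> \<le> ?L (j0 + t)"
          by (rule stall_level_le[OF K2])
        also have "\<dots> \<le> v * ?L (j0 + t)"
          using v(1) by simp
        finally show ?thesis .
      qed
      ultimately obtain i where i: "v * ?L (j0 + i) \<le> t" "t < v * ?L (j0 + Suc i)"
        using ex_least_nat_less[of "\<lambda>i. t < v * ?L (j0 + i)" t] by (auto simp: not_less)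
      show ?thesis
      proof (rule speed_if_no_bad_sites[OF flat_evolution_pinned _ K(1) K2 v(1) v(2) _ i(1)])
        fix z :: "(int ^ 'n) \<times> int" assume "z \<in> zball (int (?M * t)) (0, 0)"
        moreover have "?M * t \<le> ?M * (v * ?L (Suc (j0 + i)))"
          using i(2) by (intro mult_left_mono) auto
        then have "zball (int (?M * t)) (0 :: int ^ 'n, 0) \<subseteq> zball (int (?M * (v * ?L (Suc (j0 + i))))) (0, 0)"
          by (intro zball_mono) (simp only: of_nat_le_iff)
        ultimately show "\<not> hit (bad K (j0 + i) z) (pins \<omega> s)"
          using j0[of "j0 + i"] unfolding F_def hit_def by (meson UN_I le_add1 subsetD)
      qed simp
    qed
    have "eventually (\<lambda>t. ereal (1 / (2 * real v))
        \<le> ereal_of_zbar (surface_at (\<lambda>z. ereal (\<omega> z s)) (\<lambda>_. Fin 0) t 0) / ereal (real t)) sequentially"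
      unfolding eventually_sequentially
    proof (intro exI[of _ "v * ?L j0"] allI impI)
      fix t assume t: "v * ?L j0 \<le> t"
      have "0 < v * ?L j0"
        using v(1) L1[of j0] by (simp add: Suc_le_eq)
      then have "0 < t"
        using t by linarith
      then have "1 / (2 * real v) \<le> real_of_int (?u t 0) / real t"
        using speed[OF t] v(1) by (simp add: field_simps)
      then show "ereal (1 / (2 * real v))
          \<le> ereal_of_zbar (surface_at (\<lambda>z. ereal (\<omega> z s)) (\<lambda>_. Fin 0) t 0) / ereal (real t)"
        using \<open>0 < t\<close> by (simp add: surface_at_flat)
    qed
    then have "ereal (1 / (2 * real v)) \<le> liminf (\<lambda>t. ereal_of_zbar
        (surface_at (\<lambda>z. ereal (\<omega> z s)) (\<lambda>_. Fin 0) t 0) / ereal (real t))"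
      by (rule Liminf_bounded)
    moreover have "0 < ereal (1 / (2 * real v))"
      using v(1) by simp
    ultimately show "liminf (\<lambda>t. ereal_of_zbar
        (surface_at (\<lambda>z. ereal (\<omega> z s)) (\<lambda>_. Fin 0) t 0) / ereal (real t)) > 0"
      by (rule less_le_trans[rotated])
  qed
qed

theorem lemma4p2:
  fixes a :: nat
  assumes "a \<ge> 1"
  shows "\<exists>p0 > 0. \<forall>p::real. 0 < p \<and> p < p0 \<longrightarrow>
    (\<forall>(M :: 'w measure) (\<omega> :: (int ^ 'n::finite) \<times> int \<Rightarrow> 'w \<Rightarrow> real).
      bernoulli_disorder p M \<omega> \<longrightarrow>
        (\<forall>h::nat. h \<ge> 10 \<longrightarrow>
          (\<exists>c > 0. \<exists>\<rho> > 0. \<forall>L::nat. real L \<ge> c \<longrightarrow>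
            {s \<in> space M. \<exists>S. blocks a h L (\<lambda>z. ereal (\<omega> z s)) S} \<in> sets M \<and>
            measure M {s \<in> space M. \<exists>S. blocks a h L (\<lambda>z. ereal (\<omega> z s)) S}
              \<le> real L powr (- \<rho>))) \<and>
        (AE s in M.
          liminf (\<lambda>t. ereal_of_zbar (surface_at (\<lambda>z. ereal (\<omega> z s)) (\<lambda>_. Fin 0) t 0) / ereal (real t))
            > 0))"
proof -
  let ?n = "CARD('n)"
  let ?N = "4 * ?n + 2"
  define d where "d = ?n + 1"
  define \<gamma> where "\<gamma> = 6 * d + 1"
  (* K depends on the dimension only; p0 is then chosen small enough for this K. *)
  define K where "K = 4 * ?n + 2 * ((3 * (?n + 2)) ^ d) ^ 3"
  define \<delta> where "\<delta> = 1 / (20 * real K ^ (2 * d + 2 * \<gamma> + 1))"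
  have K1: "1 \<le> K"
    unfolding K_def by (simp add: Suc_le_eq)
  have \<delta>: "0 < \<delta>"
    unfolding \<delta>_def using K1 by simp
  have scaled: "20 * \<delta> = 1 / real K ^ (2 * d + 2 * \<gamma> + 1)"
    unfolding \<delta>_def by simp
  show ?thesis
  proof (rule exI[of _ "\<delta> ^ ?N"], intro conjI allI impI)
    show "0 < \<delta> ^ ?N"
      using \<delta> by simp
    fix p :: real and M :: "'w measure" and \<omega> :: "(int ^ 'n) \<times> int \<Rightarrow> 'w \<Rightarrow> real"
    assume p: "0 < p \<and> p < \<delta> ^ ?N" and ber: "bernoulli_disorder p M \<omega>"
    define b where "b = root ?N p"
    have b0: "0 \<le> b"
      unfolding b_def using p by simp
    have bp: "b ^ ?N = p"
      unfolding b_def by (rule real_root_pow_pos2) (use p in auto)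
    have "b \<le> \<delta>"
    proof (rule power_le_imp_le_base)
      show "b ^ Suc (4 * ?n + 1) \<le> \<delta> ^ Suc (4 * ?n + 1)"
        using bp p by simp
    qed (use \<delta> in simp)
    then have b1: "20 * b \<le> 1 / real K ^ (2 * d + 2 * \<gamma> + 1)"
      using scaled by linarith
    also have "\<dots> \<le> 1 / 1"
      by (rule frac_le) (simp, simp, simp, rule one_le_power, use K1 in simp)
    finally have "20 * b \<le> 1 / 1" .
    then have b: "20 * b \<le> 1" by simp
    have "(20 * b) ^ K \<le> (20 * b) ^ 1"
      by (rule power_decreasing[OF K1]) (use b b0 in auto)
    then have "(20 * b) ^ K \<le> 1 / real K ^ (2 * d + 2 * \<gamma> + 1)"
      using b1 by simp
    then have small: "(20 * b) ^ K * real K ^ (2 * d + 2 * \<gamma> + 1) \<le> 1"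
      using K1 by (simp add: field_simps)
    note ber' = ber[folded bp]
    show "AE s in M.
        liminf (\<lambda>t. ereal_of_zbar (surface_at (\<lambda>z. ereal (\<omega> z s)) (\<lambda>_. Fin 0) t 0) / ereal (real t)) > 0"
    proof (rule positive_speed[OF ber' b0 b])
      show "4 * ?n \<le> K" "2 * ((3 * (?n + 2)) ^ (?n + 1)) ^ 3 \<le> K"
        unfolding K_def d_def by auto
      show "(20 * b) ^ K * real K ^ (2 * (?n + 1) + 2 * (6 * (?n + 1) + 1) + 1) \<le> 1"
        using small unfolding \<gamma>_def d_def .
    qed
    fix h :: nat assume h: "10 \<le> h"
    obtain c where c: "c > 0" "\<forall>L::nat. real L \<ge> c \<longrightarrow>
        measure M {s \<in> space M. \<exists>S. blocks a h L (\<lambda>z. ereal (\<omega> z s)) S} \<le> real L powr (- 1)"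
      using finite_size_criterion[OF ber' b0 b assms h] by blast
    have "{s \<in> space M. \<exists>S. blocks a h L (\<lambda>z. ereal (\<omega> z s)) S} \<in> sets M" for L
      by (rule blocks_event_measurable[OF bernoulli_measurable[OF ber]])
    with c show "\<exists>c > 0. \<exists>\<rho> > 0. \<forall>L::nat. real L \<ge> c \<longrightarrow>
        {s \<in> space M. \<exists>S. blocks a h L (\<lambda>z. ereal (\<omega> z s)) S} \<in> sets M \<and>
        measure M {s \<in> space M. \<exists>S. blocks a h L (\<lambda>z. ereal (\<omega> z s)) S} \<le> real L powr (- \<rho>)"
      by (intro exI[of _ c] conjI exI[of _ 1]) auto
  qed
qed

end
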